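(* Let $W$ be either the weight $$W_{p,n}(x)=(1-x^2)^{\frac n2-1}\begin{pmatrix} p\,x^2+n-p & -nx\\ -nx & (n-p)x^2+p\end{pmatrix},\quad x\in[-1,1],$$ with real parameters $0<p<n/2$, or the weight $$\tilde W(t)=e^{-t^2}e^{tM}e^{tM^*},\quad t\in\mathbb R,\qquad M=\begin{pmatrix}0&a\\0&0\end{pmatrix},\ a\in\mathbb C\setminus\{0\}.$$ Then $$C_{\mathbf D}(\mathcal Z(W))=\mathcal D(W),$$ where $\mathcal Z(W)$ is the center of $\mathcal D(W)$.
   Context: $M_2$ denotes complex $2\times2$ matrices, $T^*$ the conjugate transpose. For a weight $W$ of size $2$ on an interval $(c,d)$ (here $(-1,1)$ or $\mathbb R$), on $M_2[x]$ use the matrix-valued form $(P,Q)=\int_c^d P(x)W(x)Q(x)^*\,dx$; $\{Q_w\}_{w\ge0}$ is the unique sequence of monic orthogonal polynomials ($Q_w\in M_2[x]$ monic of degree $w$, $(Q_w,Q_{w'})=0$ for $w\ne w'$). The Weyl algebra over $M_2$ is $$\mathbf D=\Bigl\{D=\sum_{i=0}^s\partial^iF_i:\ F_i\in M_2[x]\Bigr\},\quad \partial=\tfrac{d}{dx},$$ whose elements act on $M_2[x]$ on the right by $PD=\sum_i\partial^i(P)F_i$, with product determined by $P(DE)=(PD)E$. Its subalgebra $\mathcal D(W)$ consists of the $D\in\mathbf D$ such that for every $w\ge0$ there is $\Lambda_w(D)\in M_2$ with $Q_wD=\Lambda_w(D)Q_w$. For a subset $S$ of $\mathbf D$, $C_{\mathbf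 D}(S)$ denotes the centralizer of $S$ in $\mathbf D$. *)

theory Defs
  imports "HOL-Analysis.Analysis" "HOL-Computational_Algebra.Polynomial"
begin

text \<open>
  \<open>M\<^sub>2\<close> is \<^typ>\<open>complex^2^2\<close>, and \<open>M\<^sub>2[x]\<close> is identified with the two-by-two matrices over
  \<open>\<complex>[x]\<close>. The matrix product is always \<open>**\<close>; note that \<open>*\<close> on vectors of vectors is the
  entrywise product, so that neither \<open>(complex^2^2) poly\<close> nor \<^const>\<open>exp\<close> at type
  \<^typ>\<open>complex^2^2\<close> is what is needed here.
\<close>

type_synonym mat2 = "complex^2^2"
type_synonym mpoly2 = "complex poly^2^2"

definition ctranspose :: "mat2 \<Rightarrow> mat2" where
  "ctranspose A = (\<chi> i j. cnj (A $ j $ i))"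

definition mat_exp :: "mat2 \<Rightarrow> mat2" where
  "mat_exp A = (\<Sum>k. (1 / fact k) *\<^sub>R (((**) A ^^ k) (mat 1)))"

definition mpoly_const :: "mat2 \<Rightarrow> mpoly2" where
  "mpoly_const A = map_matrix (\<lambda>c. [:c:]) A"

definition mpoly_eval :: "mpoly2 \<Rightarrow> real \<Rightarrow> mat2" where
  "mpoly_eval P x = map_matrix (\<lambda>p. poly p (complex_of_real x)) P"

definition mpoly_coeff :: "mpoly2 \<Rightarrow> nat \<Rightarrow> mat2" where
  "mpoly_coeff P k = map_matrix (\<lambda>p. coeff p k) P"

definition mpoly_monic :: "nat \<Rightarrow> mpoly2 \<Rightarrow> bool" where
  "mpoly_monic w P \<longleftrightarrow> mpoly_coeff P w = mat 1 \<and> (\<forall>k>w. mpoly_coeff P k = 0)"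


subsection \<open>Orthogonal polynomials\<close>

text \<open>A weight is given by an interval \<open>I\<close> and a function \<open>W\<close>, used only on \<open>I\<close>.\<close>

definition mform :: "real set \<Rightarrow> (real \<Rightarrow> mat2) \<Rightarrow> mpoly2 \<Rightarrow> mpoly2 \<Rightarrow> mat2" where
  "mform I W P Q = (LINT x:I|lborel. mpoly_eval P x ** W x ** ctranspose (mpoly_eval Q x))"

definition is_monic_orthogonal ::
    "real set \<Rightarrow> (real \<Rightarrow> mat2) \<Rightarrow> (nat \<Rightarrow> mpoly2) \<Rightarrow> bool" where
  "is_monic_orthogonal I W Q \<longleftrightarrow>
     (\<forall>w. mpoly_monic w (Q w)) \<and> (\<forall>w w'. w \<noteq> w' \<longrightarrow> mform I W (Q w) (Q w') = 0)"

definition monic_orthogonal :: "real set \<Rightarrow> (real \<Rightarrow> mat2) \<Rightarrow> nat \<Rightarrow> mpoly2" where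
  "monic_orthogonal I W = (THE Q. is_monic_orthogonal I W Q)"


subsection \<open>The Weyl algebra over \<open>M\<^sub>2\<close>\<close>

text \<open>
  An element \<open>\<Sum>\<^sub>i \<partial>\<^sup>i F\<^sub>i\<close> is represented by its right action on \<open>M\<^sub>2[x]\<close>. This loses
  nothing, because the action determines the coefficients (\<open>diff_op_coeffs_unique\<close>
  below), and the product \<open>D E\<close> with \<open>P(D E) = (P D)E\<close> is composition with \<open>D\<close> applied first.
\<close>

definition diff_op :: "nat \<Rightarrow> (nat \<Rightarrow> mpoly2) \<Rightarrow> mpoly2 \<Rightarrow> mpoly2" where
  "diff_op s F P = (\<Sum>i\<le>s. (map_matrix pderiv ^^ i) P ** F i)"

definition Weyl :: "(mpoly2 \<Rightarrow> mpoly2) set" where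
  "Weyl = {D. \<exists>s F. D = diff_op s F}"

definition weyl_mult :: "(mpoly2 \<Rightarrow> mpoly2) \<Rightarrow> (mpoly2 \<Rightarrow> mpoly2) \<Rightarrow> mpoly2 \<Rightarrow> mpoly2" where
  "weyl_mult D E = (\<lambda>P. E (D P))"

definition Weyl_centralizer :: "(mpoly2 \<Rightarrow> mpoly2) set \<Rightarrow> (mpoly2 \<Rightarrow> mpoly2) set" where
  "Weyl_centralizer S = {D \<in> Weyl. \<forall>E\<in>S. weyl_mult D E = weyl_mult E D}"

definition Weyl_center :: "(mpoly2 \<Rightarrow> mpoly2) set \<Rightarrow> (mpoly2 \<Rightarrow> mpoly2) set" where
  "Weyl_center A = {D \<in> A. \<forall>E\<in>A. weyl_mult D E = weyl_mult E D}"

definition DW :: "real set \<Rightarrow> (real \<Rightarrow> mat2) \<Rightarrow> (mpoly2 \<Rightarrow> mpoly2) set" where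
  "DW I W = {D \<in> Weyl. \<forall>w. \<exists>\<Lambda>::mat2.
     D (monic_orthogonal I W w) = mpoly_const \<Lambda> ** monic_orthogonal I W w}"


subsection \<open>The two families of weights\<close>

definition W_gegenbauer :: "real \<Rightarrow> real \<Rightarrow> real \<Rightarrow> mat2" where
  "W_gegenbauer p n x = (1 - x\<^sup>2) powr (n / 2 - 1) *\<^sub>R
     vector [vector [complex_of_real (p * x\<^sup>2 + n - p), complex_of_real (- n * x)],
             vector [complex_of_real (- n * x), complex_of_real ((n - p) * x\<^sup>2 + p)]]"

definition W_hermite :: "complex \<Rightarrow> real \<Rightarrow> mat2" where
  "W_hermite a t =
     (let M = vector [vector [0, a], vector [0, 0]] :: mat2
      in exp (- t\<^sup>2) *\<^sub>R (mat_exp (t *\<^sub>R M) ** mat_exp (t *\<^sub>R ctranspose M)))"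


subsection \<open>Uniqueness of the coefficients of a differential operator\<close>

lemma map_matrix_pderiv_funpow:
  "(map_matrix pderiv ^^ i) P $ a $ b = (pderiv ^^ i) (P $ a $ b)"
  by (induction i arbitrary: P) simp_all

lemma pderiv_funpow_monom_self: "(pderiv ^^ k) (monom (1::complex) k) = [:fact k:]"
  by (rule poly_eqI) (simp add: coeff_higher_pderiv pochhammer_fact coeff_pCons split: nat.split)

lemma pderiv_funpow_monom_gt: "k < i \<Longrightarrow> (pderiv ^^ i) (monom (1::complex) k) = 0"
  by (rule poly_eqI) (simp add: coeff_higher_pderiv)

lemma diff_op_coeffs_unique:
  assumes "diff_op s F = diff_op s G" and "k \<le> s"
  shows "F k = G k"
  using assms(2)
proof (induction k rule: less_induct)
  case (less k)
  define P :: mpoly2 where "P = (\<chi> i j. if i = j then monom 1 k else 0)"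
  have gt: "(map_matrix pderiv ^^ i) P = 0" if "k < i" for i
    using that by (simp add: vec_eq_iff map_matrix_pderiv_funpow P_def pderiv_funpow_monom_gt)
  have self: "(map_matrix pderiv ^^ k) P = (\<chi> i j. if i = j then [:fact k:] else 0)"
    by (simp add: vec_eq_iff map_matrix_pderiv_funpow P_def pderiv_funpow_monom_self)
  have split: "diff_op s H P =
      (\<Sum>i<k. (map_matrix pderiv ^^ i) P ** H i) + (map_matrix pderiv ^^ k) P ** H k" for H
  proof -
    have "diff_op s H P = (\<Sum>i\<le>k. (map_matrix pderiv ^^ i) P ** H i)"
      unfolding diff_op_def using less.prems gt
      by (intro sum.mono_neutral_right) (auto simp: vec_eq_iff matrix_matrix_mult_def)
    then show ?thesis
      by (simp add: lessThan_Suc_atMost[symmetric])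
  qed
  have "(\<Sum>i<k. (map_matrix pderiv ^^ i) P ** F i) = (\<Sum>i<k. (map_matrix pderiv ^^ i) P ** G i)"
    using less by (intro sum.cong) auto
  then have "(map_matrix pderiv ^^ k) P ** F k = (map_matrix pderiv ^^ k) P ** G k"
    using split[of F] split[of G] assms(1) by simp
  then show ?case
    unfolding self by (simp add: vec_eq_iff matrix_matrix_mult_def if_distrib if_distribR
        poly_eq_iff[of "smult _ _"] poly_eq_iff[of "_ $ _ $ _"] cong: if_cong)
qed

end

theory Submission
  imports Defs "HOL-Probability.Distributions" "HOL-Real_Asymp.Real_Asymp"
begin

text \<open>
  For both weights there is a second-order operator \<open>S\<close> that is symmetric with respect to \<open>W\<close>, does
  not raise degrees, and acts on leading coefficients of degree \<open>w\<close> by an antidiagonal matrix whose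
  square is a scalar \<open>\<mu>\<^sub>w\<close>, with \<open>w \<mapsto> \<mu>\<^sub>w\<close> injective. Hence \<open>E = S\<^sup>2\<close> satisfies
  \<open>Q\<^sub>w E = \<mu>\<^sub>w Q\<^sub>w\<close>; having scalar eigenvalues, it is central in \<open>\<D>(W)\<close>. An operator \<open>D\<close> commuting with
  \<open>E\<close> preserves the eigenspace \<open>M\<^sub>2 Q\<^sub>w\<close> of \<open>\<mu>\<^sub>w\<close>, so it lies in \<open>\<D>(W)\<close>.
\<close>


subsection \<open>Matrix polynomials\<close>

text \<open>The center is never determined. One central element suffices: a larger commuting set has
  a smaller centralizer, and the inclusion of D(W) in the centralizer of its center is formal.
  \<open>S\<close> itself does not serve, since its eigenvalue on Q_w is a non-scalar matrix that
  need not commute with the eigenvalues of other operators; squaring repairs this. An element of the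
  Weyl algebra may raise degrees, so Q_w D is not known in advance to have degree w; triangularity
  of \<open>E\<close> and the distinctness of the \<mu>_w exclude contributions from every other
  degree. The real computation is the symmetry of \<open>S\<close>. Both weights are a scalar
  density \<phi> times a polynomial matrix, and \<phi> satisfies a Pearson equation (\<phi>
  \<sigma>)' = \<phi> \<tau> with no boundary terms at the ends of the interval. A polynomial of the
  form \<sigma> G' + \<tau> G therefore integrates to zero against \<phi>, and symmetry reduces to
  exhibiting a G for which an identity of polynomials holds.\<close>

lemma matrix_add_rdistrib: "(A + B) ** C = A ** C + B ** C" for C :: "'a::semiring_1^'n^'m"
  by (simp add: vec_eq_iff matrix_matrix_mult_def distrib_right sum.distrib)

lemma matrix_diff_ldistrib: "A ** (B - C) = A ** B - A ** C" for A :: "'a::ring_1^'n^'m"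
  by (simp add: vec_eq_iff matrix_matrix_mult_def right_diff_distrib sum_subtractf)

lemma matrix_sum_rdistrib: "(\<Sum>i\<in>S. f i) ** C = (\<Sum>i\<in>S. f i ** C)" for C :: "'a::ring_1^'n^'m"
  by (induction S rule: infinite_finite_induct) (simp_all add: matrix_add_rdistrib)

lemma matrix_sum_ldistrib: "C ** (\<Sum>i\<in>S. f i) = (\<Sum>i\<in>S. C ** f i)" for C :: "'a::ring_1^'n^'m"
  by (induction S rule: infinite_finite_induct) (simp_all add: matrix_add_ldistrib)

lemma mpoly_const_mult: "mpoly_const (A ** B) = mpoly_const A ** mpoly_const B"
  by (simp add: mpoly_const_def vec_eq_iff matrix_matrix_mult_def sum_2)

lemma mpoly_const_one: "mpoly_const (mat 1) = mat 1"
  by (simp add: mpoly_const_def vec_eq_iff mat_def)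

lemma mat_scalar_commute: "A ** mat c = mat c ** A" for A :: "'a::comm_semiring_1^'n^'n"
  by (simp add: vec_eq_iff matrix_matrix_mult_def mat_def if_distrib if_distribR mult.commute
      cong: if_cong)

lemma mpoly_const_scalar_commute:
  "mpoly_const A ** (mpoly_const (mat c) ** P) = mpoly_const (mat c) ** (mpoly_const A ** P)"
  by (simp add: matrix_mul_assoc mpoly_const_mult[symmetric] mat_scalar_commute)

lemma mpoly_coeff_const_mult: "mpoly_coeff (mpoly_const A ** P) k = A ** mpoly_coeff P k"
  by (simp add: mpoly_coeff_def mpoly_const_def vec_eq_iff matrix_matrix_mult_def sum_2)

lemma mpoly_coeff_add: "mpoly_coeff (P + Q) k = mpoly_coeff P k + mpoly_coeff Q k"
  by (simp add: mpoly_coeff_def vec_eq_iff)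

lemma mpoly_coeff_diff: "mpoly_coeff (P - Q) k = mpoly_coeff P k - mpoly_coeff Q k"
  by (simp add: mpoly_coeff_def vec_eq_iff)

lemma mpoly_coeff_zero [simp]: "mpoly_coeff 0 k = 0"
  by (simp add: mpoly_coeff_def vec_eq_iff)

lemmas mpoly_coeff_simps = mpoly_coeff_const_mult mpoly_coeff_add mpoly_coeff_diff

lemma mpoly_eqI: "(\<And>k. mpoly_coeff P k = mpoly_coeff Q k) \<Longrightarrow> P = Q"
  by (simp add: mpoly_coeff_def vec_eq_iff poly_eq_iff)

text \<open>The bound is strict, so that w = 0 describes exactly the zero polynomial and can start
  every induction on the degree.\<close>

definition mpoly_deg_less :: "nat \<Rightarrow> mpoly2 \<Rightarrow> bool" where
  "mpoly_deg_less w P \<longleftrightarrow> (\<forall>k\<ge>w. mpoly_coeff P k = 0)"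

lemma mpoly_deg_lessD: "mpoly_deg_less w P \<Longrightarrow> w \<le> k \<Longrightarrow> mpoly_coeff P k = 0"
  by (simp add: mpoly_deg_less_def)

lemma mpoly_deg_less_mono: "mpoly_deg_less v P \<Longrightarrow> v \<le> w \<Longrightarrow> mpoly_deg_less w P"
  by (simp add: mpoly_deg_less_def)

lemma mpoly_deg_less_0: "mpoly_deg_less 0 P \<longleftrightarrow> P = 0"
  by (auto simp: mpoly_deg_less_def intro: mpoly_eqI)

lemma mpoly_deg_less_add: "mpoly_deg_less w P \<Longrightarrow> mpoly_deg_less w Q \<Longrightarrow> mpoly_deg_less w (P + Q)"
  by (simp add: mpoly_deg_less_def mpoly_coeff_add)

lemma mpoly_deg_less_diff: "mpoly_deg_less w P \<Longrightarrow> mpoly_deg_less w Q \<Longrightarrow> mpoly_deg_less w (P - Q)"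
  by (simp add: mpoly_deg_less_def mpoly_coeff_diff)

lemma mpoly_deg_less_const_mult: "mpoly_deg_less w P \<Longrightarrow> mpoly_deg_less w (mpoly_const A ** P)"
  by (simp add: mpoly_deg_less_def mpoly_coeff_const_mult)

lemma mpoly_deg_less_SucD:
  "mpoly_deg_less (Suc w) P \<Longrightarrow> mpoly_coeff P w = 0 \<Longrightarrow> mpoly_deg_less w P"
  unfolding mpoly_deg_less_def by (metis le_antisym not_less_eq_eq)

lemma mpoly_deg_less_exists: "\<exists>w. mpoly_deg_less w P"
proof -
  define w where "w = Suc (Max (range (\<lambda>(i, j). degree (P $ i $ j))))"
  have "degree (P $ i $ j) < w" for i j
    unfolding w_def by (auto simp: less_Suc_eq_le intro!: Max_ge)
  then have "coeff (P $ i $ j) k = 0" if "w \<le> k" for i j k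
    using that by (metis coeff_eq_0 order_less_le_trans)
  then have "mpoly_deg_less w P"
    by (simp add: mpoly_deg_less_def mpoly_coeff_def vec_eq_iff)
  then show ?thesis ..
qed

lemma mpoly_monicD:
  assumes "mpoly_monic w P"
  shows "mpoly_coeff P w = mat 1" "mpoly_deg_less (Suc w) P"
  using assms by (auto simp: mpoly_monic_def mpoly_deg_less_def)

lemma mpoly_monic_reduce:
  assumes "mpoly_monic w B" "mpoly_deg_less (Suc w) P"
  shows "mpoly_deg_less w (P - mpoly_const (mpoly_coeff P w) ** B)"
  by (rule mpoly_deg_less_SucD)
     (simp_all add: mpoly_coeff_simps mpoly_deg_less_diff mpoly_deg_less_const_mult
        mpoly_monicD[OF assms(1)] assms(2))

lemma mpoly_monic_exists: "\<exists>B. mpoly_monic w B"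
  by (intro exI[of _ "\<chi> i j. if i = j then monom 1 w else 0"])
     (simp add: mpoly_monic_def mpoly_coeff_def vec_eq_iff mat_def)

lemma mpoly_monic_diff_lower:
  "mpoly_monic w B \<Longrightarrow> mpoly_deg_less w U \<Longrightarrow> mpoly_monic w (B - U)"
  by (simp add: mpoly_monic_def mpoly_deg_less_def mpoly_coeff_diff)

text \<open>Subtracting a left multiple of \<open>B w\<close> removes the leading coefficient, so a
  monic sequence is a left M_2-basis. Left linear operators can thus be compared on the Q_w
  alone.\<close>

lemma mpoly_monic_basis_induct [case_names monic zero add]:
  assumes "\<And>w. mpoly_monic w (B w)"
    and "R 0"
    and "\<And>P A w. mpoly_deg_less w P \<Longrightarrow> R P \<Longrightarrow> R (P + mpoly_const A ** B w)"
  shows "R P"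
proof -
  have "mpoly_deg_less w P \<Longrightarrow> R P" for w
  proof (induction w arbitrary: P)
    case 0
    then show ?case using assms(2) by (simp add: mpoly_deg_less_0)
  next
    case (Suc w)
    let ?P = "P - mpoly_const (mpoly_coeff P w) ** B w"
    have "mpoly_deg_less w ?P"
      using mpoly_monic_reduce assms(1) Suc.prems by blast
    from assms(3)[OF this Suc.IH[OF this], of "mpoly_coeff P w"] show ?case by simp
  qed
  then show ?thesis using mpoly_deg_less_exists by blast
qed


subsection \<open>The Weyl algebra\<close>

lemma map_matrix_pderiv_add:
  "map_matrix pderiv (P + Q) = map_matrix pderiv P + map_matrix pderiv (Q :: mpoly2)"
  by (simp add: vec_eq_iff pderiv_add)

lemma map_matrix_pderiv_mult:
  "map_matrix pderiv (P ** Q) = map_matrix pderiv P ** Q + P ** map_matrix pderiv (Q :: mpoly2)"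
  by (simp add: vec_eq_iff matrix_matrix_mult_def sum_2 pderiv_add pderiv_mult algebra_simps)

lemma map_matrix_pderiv_const_mult:
  "map_matrix pderiv (mpoly_const A ** P) = mpoly_const A ** map_matrix pderiv P"
  by (simp add: vec_eq_iff matrix_matrix_mult_def sum_2 mpoly_const_def pderiv_add pderiv_smult)

lemma map_matrix_pderiv_pow_add:
  "(map_matrix pderiv ^^ i) (P + Q) = (map_matrix pderiv ^^ i) P + (map_matrix pderiv ^^ i) (Q :: mpoly2)"
  by (induction i arbitrary: P Q) (simp_all add: map_matrix_pderiv_add)

lemma map_matrix_pderiv_pow_const_mult:
  "(map_matrix pderiv ^^ i) (mpoly_const A ** P) = mpoly_const A ** (map_matrix pderiv ^^ i) P"
  by (induction i arbitrary: P) (simp_all add: map_matrix_pderiv_const_mult)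

lemma diff_op_add: "diff_op s F (P + Q) = diff_op s F P + diff_op s F Q"
  by (simp add: diff_op_def map_matrix_pderiv_pow_add matrix_add_rdistrib sum.distrib)

lemma diff_op_const_mult: "diff_op s F (mpoly_const A ** P) = mpoly_const A ** diff_op s F P"
  by (simp add: diff_op_def map_matrix_pderiv_pow_const_mult matrix_mul_assoc matrix_sum_ldistrib)

lemma Weyl_add: "D \<in> Weyl \<Longrightarrow> D (P + Q) = D P + D Q"
  by (auto simp: Weyl_def diff_op_add)

lemma Weyl_const_mult: "D \<in> Weyl \<Longrightarrow> D (mpoly_const A ** P) = mpoly_const A ** D P"
  by (auto simp: Weyl_def diff_op_const_mult)

lemma Weyl_zero: "D \<in> Weyl \<Longrightarrow> D 0 = 0"
  using Weyl_add[of D 0 0] by simp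

lemma Weyl_diff: "D \<in> Weyl \<Longrightarrow> D (P - Q) = D P - D Q"
  using Weyl_add[of D "P - Q" Q] by simp

lemma Weyl_zero_op: "(\<lambda>P. 0) \<in> Weyl"
  unfolding Weyl_def by (intro CollectI exI[of _ 0] exI[of _ "\<lambda>_. 0"] ext) (simp add: diff_op_def)

lemma diff_op_pad:
  assumes "s \<le> m"
  shows "diff_op s F = diff_op m (\<lambda>i. if i \<le> s then F i else 0)"
  unfolding diff_op_def using assms
  by (intro ext sum.mono_neutral_cong_left) auto

lemma Weyl_add_op:
  assumes "D \<in> Weyl" "E \<in> Weyl"
  shows "(\<lambda>P. D P + E P) \<in> Weyl"
proof -
  from assms obtain s F t G where "D = diff_op s F" "E = diff_op t G"
    by (auto simp: Weyl_def)
  then obtain F' G' where "D = diff_op (max s t) F'" "E = diff_op (max s t) G'"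
    using diff_op_pad[of s "max s t" F] diff_op_pad[of t "max s t" G] by auto
  then have "(\<lambda>P. D P + E P) = diff_op (max s t) (\<lambda>i. F' i + G' i)"
    by (simp add: fun_eq_iff diff_op_def matrix_add_ldistrib sum.distrib)
  then show ?thesis by (auto simp: Weyl_def)
qed

lemma Weyl_sum_op:
  assumes "\<And>i. i \<in> S \<Longrightarrow> D i \<in> Weyl"
  shows "(\<lambda>P. \<Sum>i\<in>S. D i P) \<in> Weyl"
  using assms
  by (induction S rule: infinite_finite_induct) (simp_all add: Weyl_zero_op Weyl_add_op)

lemma Weyl_monomial: "(\<lambda>P. (map_matrix pderiv ^^ i) P ** F) \<in> Weyl"
proof -
  have "(\<lambda>P. (map_matrix pderiv ^^ i) P ** F) = diff_op i (\<lambda>k. if k = i then F else 0)"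
    by (simp add: fun_eq_iff diff_op_def if_distrib cong: if_cong)
  then show ?thesis by (auto simp: Weyl_def)
qed

lemma Weyl_mult_right:
  assumes "D \<in> Weyl"
  shows "(\<lambda>P. D P ** G) \<in> Weyl"
proof -
  from assms obtain s F where "D = diff_op s F" by (auto simp: Weyl_def)
  then have "(\<lambda>P. D P ** G) = diff_op s (\<lambda>i. F i ** G)"
    by (simp add: fun_eq_iff diff_op_def matrix_sum_rdistrib matrix_mul_assoc)
  then show ?thesis by (auto simp: Weyl_def)
qed

lemma Weyl_deriv:
  assumes "D \<in> Weyl"
  shows "(\<lambda>P. map_matrix pderiv (D P)) \<in> Weyl"
proof -
  from assms obtain s F where D: "D = diff_op s F" by (auto simp: Weyl_def)
  have "map_matrix pderiv (\<Sum>i\<in>S. f i) = (\<Sum>i\<in>S. map_matrix pderiv (f i :: mpoly2))" for S :: "nat set" and f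
    by (induction S rule: infinite_finite_induct) (simp_all add: map_matrix_pderiv_add vec_eq_iff)
  then have "(\<lambda>P. map_matrix pderiv (D P)) =
      (\<lambda>P. \<Sum>i\<le>s. (map_matrix pderiv ^^ Suc i) P ** F i
               + (map_matrix pderiv ^^ i) P ** map_matrix pderiv (F i))"
    by (simp add: D fun_eq_iff diff_op_def map_matrix_pderiv_mult)
  also have "\<dots> \<in> Weyl"
    by (intro Weyl_sum_op Weyl_add_op Weyl_monomial)
  finally show ?thesis .
qed

text \<open>Closure under differentiation, right multiplication and finite sums replaces an explicit
  Leibniz formula for the coefficients of the product. It places the square of \<open>S\<close> in
  the Weyl algebra.\<close>

lemma Weyl_compose:
  assumes "D \<in> Weyl" "E \<in> Weyl"
  shows "(\<lambda>P. E (D P)) \<in> Weyl"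
proof -
  from assms(2) obtain s F where E: "E = diff_op s F" by (auto simp: Weyl_def)
  have "(\<lambda>P. (map_matrix pderiv ^^ i) (D P)) \<in> Weyl" for i
    by (induction i) (simp_all add: assms(1) Weyl_deriv)
  then show ?thesis
    unfolding E diff_op_def by (intro Weyl_sum_op Weyl_mult_right)
qed


subsection \<open>Existence and uniqueness of the orthogonal polynomials\<close>

lemma mat2_left_inverse:
  fixes G :: mat2
  assumes nondeg: "\<And>A :: mat2. A ** G = 0 \<Longrightarrow> A = 0"
  obtains H where "H ** G = mat 1"
proof -
  \<comment> \<open>The adjugate of \<open>G\<close>. If det G = 0 then J G = 0, so J = 0; as the
    entries of \<open>J\<close> are those of \<open>G\<close> up to sign, G = 0 as well, which
    nondegeneracy forbids.\<close>
  define J :: mat2 where "J = vector [vector [G$2$2, - G$1$2], vector [- G$2$1, G$1$1]]"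
  have J: "J ** G = mat (det G)"
    by (simp add: J_def vec_eq_iff matrix_matrix_mult_def mat_def sum_2 forall_2 det_2 algebra_simps)
  have "det G \<noteq> 0"
  proof
    assume "det G = 0"
    with J have "J ** G = 0" by (simp add: mat_def vec_eq_iff)
    then have "J = 0" by (rule nondeg)
    then have "G = 0" by (simp add: J_def vec_eq_iff forall_2)
    then have "mat 1 ** G = 0" by simp
    then have "mat 1 = (0 :: mat2)" by (rule nondeg)
    then have "(mat 1 :: mat2) $ 1 $ 1 = 0" by simp
    then show False by (simp add: mat_def)
  qed
  then have "mat (inverse (det G)) ** J ** G = mat 1"
    by (simp add: matrix_mul_assoc[symmetric] J)
       (simp add: vec_eq_iff matrix_matrix_mult_def mat_def sum_2 forall_2)
  then show thesis by (rule that)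
qed

lemma ctranspose_zero [simp]: "ctranspose 0 = 0"
  by (simp add: ctranspose_def vec_eq_iff)

lemma ctranspose_add: "ctranspose (A + B) = ctranspose A + ctranspose B"
  by (simp add: ctranspose_def vec_eq_iff)

lemma ctranspose_mult: "ctranspose (A ** B) = ctranspose B ** ctranspose A"
  by (simp add: ctranspose_def vec_eq_iff matrix_matrix_mult_def mult.commute)

text \<open>These are the facts about the weight on which Gram-Schmidt over M_2 rests; conjugate
  linearity in the second argument follows from Hermitian symmetry.\<close>

locale matrix_form =
  fixes I :: "real set" and W :: "real \<Rightarrow> mat2"
  assumes form_add_left: "mform I W (P + Q) R = mform I W P R + mform I W Q R"
    and form_const_left: "mform I W (mpoly_const A ** P) Q = A ** mform I W P Q"
    and form_hermitian: "mform I W Q P = ctranspose (mform I W P Q)"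
    and form_definite: "mform I W P P = 0 \<Longrightarrow> P = 0"
begin

lemma form_zero_left [simp]: "mform I W 0 Q = 0"
  using form_add_left[of 0 0 Q] by simp

lemma form_diff_left: "mform I W (P - Q) R = mform I W P R - mform I W Q R"
  using form_add_left[of "P - Q" Q R] by simp

lemma form_add_right: "mform I W R (P + Q) = mform I W R P + mform I W R Q"
  by (metis form_add_left form_hermitian ctranspose_add)

lemma form_const_right: "mform I W P (mpoly_const A ** Q) = mform I W P Q ** ctranspose A"
  by (metis form_const_left form_hermitian ctranspose_mult)

lemma form_zero_right [simp]: "mform I W Q 0 = 0"
  using form_add_right[of Q 0 0] by simp

lemma form_eq_0_sym: "mform I W P Q = 0 \<Longrightarrow> mform I W Q P = 0"
  by (metis ctranspose_zero form_hermitian)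

text \<open>Gram-Schmidt, for all \<open>P\<close> at once: the induction step projects a monic
  polynomial, to obtain a new basis element \<open>B\<close> orthogonal to lower degrees, and also
  \<open>P\<close> itself.\<close>

lemma projection_exists:
  "\<exists>U. mpoly_deg_less w U \<and> (\<forall>V. mpoly_deg_less w V \<longrightarrow> mform I W (P - U) V = 0)"
proof (induction w arbitrary: P)
  case 0
  show ?case by (auto simp: mpoly_deg_less_0)
next
  case (Suc w)
  obtain B0 where "mpoly_monic w B0" using mpoly_monic_exists by blast
  moreover obtain U0 where "mpoly_deg_less w U0"
      and U0: "\<And>V. mpoly_deg_less w V \<Longrightarrow> mform I W (B0 - U0) V = 0"
    using Suc.IH by blast
  moreover define B where "B = B0 - U0"
  ultimately have monic: "mpoly_monic w B"
    and orth: "\<And>V. mpoly_deg_less w V \<Longrightarrow> mform I W B V = 0"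
    by (simp_all add: mpoly_monic_diff_lower)
  \<comment> \<open>If A (B,B) = 0, then (AB,AB) = 0, hence AB = 0 by definiteness, and the leading
    coefficient of AB is A. So the Gram matrix of \<open>B\<close> is invertible.\<close>
  have "A = 0" if "A ** mform I W B B = 0" for A :: mat2
  proof -
    have "mpoly_const A ** B = 0"
      using that by (intro form_definite) (simp add: form_const_left form_const_right matrix_mul_assoc)
    then have "A ** mpoly_coeff B w = 0"
      by (metis mpoly_coeff_const_mult mpoly_coeff_zero)
    then show ?thesis using mpoly_monicD[OF monic] by simp
  qed
  then obtain H where H: "H ** mform I W B B = mat 1"
    by (rule mat2_left_inverse)
  obtain U1 where U1: "mpoly_deg_less w U1" "\<And>V. mpoly_deg_less w V \<Longrightarrow> mform I W (P - U1) V = 0"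
    using Suc.IH by blast
  \<comment> \<open>The Fourier coefficient of \<open>P\<close> along \<open>B\<close>, chosen so
    that A (B,B) = (P,B).\<close>
  define A where "A = mform I W P B ** H"
  define U where "U = U1 + mpoly_const A ** B"
  have "A ** mform I W B B = mform I W P B"
    by (simp add: A_def matrix_mul_assoc[symmetric] H)
  then have PB: "mform I W (P - U) B = 0"
    using form_eq_0_sym[OF orth[OF U1(1)]]
    by (simp add: U_def form_diff_left form_add_left form_const_left)
  have low: "mform I W (P - U) V = 0" if "mpoly_deg_less w V" for V
    using U1(2)[OF that] orth[OF that]
    by (simp add: U_def form_diff_left form_add_left form_const_left)
  have "mform I W (P - U) V = 0" if "mpoly_deg_less (Suc w) V" for V
  proof -
    let ?V = "V - mpoly_const (mpoly_coeff V w) ** B"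
    have "mform I W (P - U) (?V + mpoly_const (mpoly_coeff V w) ** B) = 0"
      unfolding form_add_right form_const_right PB
      using low[OF mpoly_monic_reduce[OF monic that]] by simp
    then show ?thesis by simp
  qed
  moreover have "mpoly_deg_less (Suc w) U"
    unfolding U_def using U1(1) mpoly_monicD[OF monic]
    by (intro mpoly_deg_less_add mpoly_deg_less_const_mult) (auto elim: mpoly_deg_less_mono)
  ultimately show ?case by blast
qed

lemma monic_orthogonal_exists: "\<exists>Q. is_monic_orthogonal I W Q"
proof -
  have "\<exists>B. mpoly_monic w B \<and> (\<forall>V. mpoly_deg_less w V \<longrightarrow> mform I W B V = 0)" for w
    using mpoly_monic_exists[of w] projection_exists[of w] mpoly_monic_diff_lower by meson
  then obtain Q where monic: "\<And>w. mpoly_monic w (Q w)"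
    and orth: "\<And>w V. mpoly_deg_less w V \<Longrightarrow> mform I W (Q w) V = 0"
    by metis
  have "mform I W (Q w) (Q w') = 0" if "w' < w" for w w'
    using mpoly_monicD(2)[OF monic[of w']] that by (intro orth) (auto elim: mpoly_deg_less_mono)
  then have "mform I W (Q w) (Q w') = 0" if "w \<noteq> w'" for w w'
    using that form_eq_0_sym by (metis nat_neq_iff)
  with monic show ?thesis unfolding is_monic_orthogonal_def by blast
qed

lemma is_monic_orthogonal_lower:
  assumes "is_monic_orthogonal I W Q" "mpoly_deg_less w V"
  shows "mform I W (Q w) V = 0"
proof -
  have "mpoly_deg_less m V \<Longrightarrow> m \<le> w \<Longrightarrow> mform I W (Q w) V = 0" for m
  proof (induction m arbitrary: V)
    case 0
    then show ?case by (simp add: mpoly_deg_less_0)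
  next
    case (Suc m)
    let ?V = "V - mpoly_const (mpoly_coeff V m) ** Q m"
    have "mpoly_deg_less m ?V"
      using assms(1) Suc.prems by (intro mpoly_monic_reduce) (auto simp: is_monic_orthogonal_def)
    then have "mform I W (Q w) ?V = 0" using Suc by simp
    moreover have "mform I W (Q w) (Q m) = 0"
      using assms(1) Suc.prems by (simp add: is_monic_orthogonal_def)
    ultimately have "mform I W (Q w) (?V + mpoly_const (mpoly_coeff V m) ** Q m) = 0"
      unfolding form_add_right form_const_right by simp
    then show ?case by simp
  qed
  then show ?thesis using assms(2) by blast
qed

text \<open>The difference of two candidates has degree below w, and both are orthogonal to such
  polynomials, so it is orthogonal to itself. With existence this gives the \<open>THE\<close> in
  \<open>monic_orthogonal\<close> its meaning.\<close>

lemma is_monic_orthogonal_unique: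
  assumes "is_monic_orthogonal I W Q" "is_monic_orthogonal I W Q'"
  shows "Q = Q'"
proof
  fix w
  have "mpoly_monic w (Q w)" "mpoly_monic w (Q' w)"
    using assms by (auto simp: is_monic_orthogonal_def)
  then have "mpoly_deg_less w (Q w - Q' w)"
    using mpoly_monic_reduce[of w "Q' w" "Q w"] mpoly_monicD[of w "Q w"]
    by (simp add: mpoly_const_one)
  then have "mform I W (Q w - Q' w) (Q w - Q' w) = 0"
    using is_monic_orthogonal_lower[OF assms(1)] is_monic_orthogonal_lower[OF assms(2)]
    by (simp add: form_diff_left)
  from form_definite[OF this] show "Q w = Q' w" by simp
qed

lemma monic_orthogonal: "is_monic_orthogonal I W (monic_orthogonal I W)"
  unfolding monic_orthogonal_def
  using monic_orthogonal_exists is_monic_orthogonal_unique by (metis theI)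

lemma monic_orthogonal_monic: "mpoly_monic w (monic_orthogonal I W w)"
  using monic_orthogonal by (simp add: is_monic_orthogonal_def)

lemmas monic_orthogonal_lower = is_monic_orthogonal_lower[OF monic_orthogonal]

end


subsection \<open>A symmetric operator with scalar square\<close>

text \<open>Taking \<open>k\<close> at or above a strict degree bound for \<open>P\<close>,
  \<open>S_leading\<close> also says that \<open>S\<close> does not raise degrees. The matrix
  \<open>N k\<close> stands on the right, where operators act; only its square, being scalar, can be
  moved to the left, where eigenvalues stand.\<close>

locale bispectral_form = matrix_form +
  fixes S :: "mpoly2 \<Rightarrow> mpoly2" and N :: "nat \<Rightarrow> mat2" and \<mu> :: "nat \<Rightarrow> complex"
  assumes S_Weyl: "S \<in> Weyl"
    and S_symmetric: "mform I W (S P) Q = mform I W P (S Q)"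
    and S_leading: "mpoly_deg_less (Suc k) P \<Longrightarrow> mpoly_coeff (S P) k = mpoly_coeff P k ** N k"
    and N_square: "N k ** N k = mat (\<mu> k)"
    and inj_\<mu>: "inj \<mu>"
begin

definition E :: "mpoly2 \<Rightarrow> mpoly2" where "E P = S (S P)"

lemma E_Weyl: "E \<in> Weyl"
  using Weyl_compose[OF S_Weyl S_Weyl] by (simp add: E_def[abs_def])

lemma S_deg_less:
  assumes "mpoly_deg_less w P"
  shows "mpoly_deg_less w (S P)"
proof -
  have "mpoly_coeff (S P) k = 0" if "w \<le> k" for k
    using S_leading[of k P] mpoly_deg_less_mono[OF assms, of "Suc k"] mpoly_deg_lessD[OF assms that]
      that by simp
  then show ?thesis by (simp add: mpoly_deg_less_def)
qed

lemma E_leading: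
  assumes "mpoly_deg_less (Suc k) P"
  shows "mpoly_coeff (E P) k = mat (\<mu> k) ** mpoly_coeff P k"
  using assms
  by (simp add: E_def S_leading S_deg_less matrix_mul_assoc[symmetric] N_square)
     (simp add: mat_scalar_commute)

lemma E_symmetric: "mform I W (E P) Q = mform I W P (E Q)"
  by (simp add: E_def S_symmetric)

lemma E_deg_less: "mpoly_deg_less w P \<Longrightarrow> mpoly_deg_less w (E P)"
  by (simp add: E_def S_deg_less)

text \<open>The defect \<open>?R\<close> has degree below w because the leading coefficients agree.
  By symmetry (R,R) is a combination of (Q_w, E R) and (Q_w, R), which both vanish.\<close>

lemma E_monic_orthogonal:
  "E (monic_orthogonal I W w) = mpoly_const (mat (\<mu> w)) ** monic_orthogonal I W w"
proof -
  let ?Q = "monic_orthogonal I W w"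
  let ?R = "E ?Q - mpoly_const (mat (\<mu> w)) ** ?Q"
  have Q: "mpoly_deg_less (Suc w) ?Q"
    using mpoly_monicD monic_orthogonal_monic by blast
  have R: "mpoly_deg_less w ?R"
    by (rule mpoly_deg_less_SucD)
      (simp_all add: Q mpoly_deg_less_diff mpoly_deg_less_const_mult E_deg_less
        mpoly_coeff_simps E_leading)
  have "mform I W ?R ?R = 0"
    unfolding form_diff_left form_const_left E_symmetric
    using monic_orthogonal_lower[OF R] monic_orthogonal_lower[OF E_deg_less[OF R]] by simp
  from form_definite[OF this] show ?thesis by simp
qed

text \<open>No degree bound on \<open>R\<close> is assumed, as it will come from an operator that
  may raise degrees. A top coefficient in degree m \<noteq> w would force \<mu>_m = \<mu>_w, and the
  one in degree w is zero by hypothesis, so the degree descends to nothing.\<close>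

lemma E_eigenvector_zero:
  assumes "E R = mpoly_const (mat (\<mu> w)) ** R" "mpoly_coeff R w = 0"
  shows "R = 0"
proof -
  have "mpoly_deg_less m R \<Longrightarrow> R = 0" for m
  proof (induction m)
    case 0
    then show ?case by (simp add: mpoly_deg_less_0)
  next
    case (Suc m)
    have "mat (\<mu> m) ** mpoly_coeff R m = mat (\<mu> w) ** mpoly_coeff R m"
      using E_leading[OF Suc.prems] by (simp add: assms(1) mpoly_coeff_const_mult)
    then have "(mat (\<mu> m) ** mpoly_coeff R m) $ i $ j = (mat (\<mu> w) ** mpoly_coeff R m) $ i $ j" for i j
      by simp
    then have "\<mu> m * mpoly_coeff R m $ i $ j = \<mu> w * mpoly_coeff R m $ i $ j" for i j
      unfolding matrix_matrix_mult_def mat_def by (simp add: if_distrib if_distribR cong: if_cong)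
    moreover have "\<mu> m \<noteq> \<mu> w" if "m \<noteq> w"
      using inj_\<mu> that by (auto dest: injD)
    ultimately have "mpoly_coeff R m = 0"
      using assms(2) by (cases "m = w") (simp_all add: vec_eq_iff)
    then show ?case using Suc mpoly_deg_less_SucD by blast
  qed
  then show ?thesis using mpoly_deg_less_exists by blast
qed

lemma E_in_DW: "E \<in> DW I W"
  using E_Weyl E_monic_orthogonal by (auto simp: DW_def)

text \<open>Scalar eigenvalues commute with every \<Lambda>, so both products agree on each Q_w, and
  then everywhere by left linearity.\<close>

lemma E_central: "E \<in> Weyl_center (DW I W)"
proof -
  have "weyl_mult E D = weyl_mult D E" if DW: "D \<in> DW I W" for D
  proof
    fix P
    let ?Q = "monic_orthogonal I W"
    have D: "D \<in> Weyl" using DW by (simp add: DW_def)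
    have "D (E P) = E (D P)"
    proof (induction P rule: mpoly_monic_basis_induct[of ?Q])
      case (monic w)
      show ?case by (rule monic_orthogonal_monic)
    next
      case zero
      then show ?case by (simp add: Weyl_zero[OF D] Weyl_zero[OF E_Weyl])
    next
      case (add P A w)
      obtain \<Lambda> where "D (?Q w) = mpoly_const \<Lambda> ** ?Q w"
        using DW by (auto simp: DW_def)
      then have "D (E (?Q w)) = E (D (?Q w))"
        by (simp add: E_monic_orthogonal Weyl_const_mult[OF D] Weyl_const_mult[OF E_Weyl]
            mpoly_const_scalar_commute)
      then show ?case
        by (simp add: Weyl_add[OF D] Weyl_add[OF E_Weyl] Weyl_const_mult[OF D]
            Weyl_const_mult[OF E_Weyl] add)
    qed
    then show "weyl_mult E D P = weyl_mult D E P" by (simp add: weyl_mult_def)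
  qed
  then show ?thesis using E_in_DW by (simp add: Weyl_center_def)
qed

theorem centralizer_center: "Weyl_centralizer (Weyl_center (DW I W)) = DW I W"
proof (intro equalityI subsetI)
  fix D assume "D \<in> DW I W"
  then show "D \<in> Weyl_centralizer (Weyl_center (DW I W))"
    by (auto simp: Weyl_centralizer_def Weyl_center_def DW_def)
next
  fix D assume "D \<in> Weyl_centralizer (Weyl_center (DW I W))"
  then have D: "D \<in> Weyl" and "weyl_mult D E = weyl_mult E D"
    using E_central by (auto simp: Weyl_centralizer_def)
  then have comm: "E (D P) = D (E P)" for P
    by (simp add: weyl_mult_def fun_eq_iff)
  have "\<exists>\<Lambda>. D (monic_orthogonal I W w) = mpoly_const \<Lambda> ** monic_orthogonal I W w" for w
  proof -
    let ?Q = "monic_orthogonal I W w"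
    \<comment> \<open>The coefficient of degree w, whatever the degree of the image: subtracting
      \<open>\<Lambda>\<close> times Q_w leaves an eigenvector whose coefficient in degree w
      vanishes.\<close>
    define \<Lambda> where "\<Lambda> = mpoly_coeff (D ?Q) w"
    have "D ?Q - mpoly_const \<Lambda> ** ?Q = 0"
    proof (rule E_eigenvector_zero)
      show "E (D ?Q - mpoly_const \<Lambda> ** ?Q) = mpoly_const (mat (\<mu> w)) ** (D ?Q - mpoly_const \<Lambda> ** ?Q)"
        by (simp add: Weyl_diff[OF E_Weyl] Weyl_const_mult[OF E_Weyl] comm E_monic_orthogonal
            Weyl_const_mult[OF D] matrix_diff_ldistrib mpoly_const_scalar_commute)
      show "mpoly_coeff (D ?Q - mpoly_const \<Lambda> ** ?Q) w = 0"
        using mpoly_monicD[OF monic_orthogonal_monic] by (simp add: mpoly_coeff_simps \<Lambda>_def)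
    qed
    then show ?thesis by auto
  qed
  with D show "D \<in> DW I W" by (auto simp: DW_def)
qed

end


subsection \<open>Weights with polynomial matrix part\<close>

lemma map_poly_cnj_add: "map_poly cnj (p + q) = map_poly cnj p + map_poly cnj q"
  by (rule poly_eqI) (simp add: coeff_map_poly)

lemma map_poly_cnj_diff: "map_poly cnj (p - q) = map_poly cnj p - map_poly cnj q"
  by (rule poly_eqI) (simp add: coeff_map_poly)

lemma map_poly_cnj_mult: "map_poly cnj (p * q) = map_poly cnj p * map_poly cnj q"
  by (rule poly_eqI) (simp add: coeff_map_poly coeff_mult)

lemma map_poly_cnj_pderiv: "map_poly cnj (pderiv p) = pderiv (map_poly cnj p)"
  by (rule poly_eqI) (simp add: coeff_map_poly coeff_pderiv)

lemma map_poly_cnj_cnj [simp]: "map_poly cnj (map_poly cnj p) = p"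
  by (rule poly_eqI) (simp add: coeff_map_poly)

lemmas map_poly_cnj_simps = map_poly_cnj_add map_poly_cnj_diff map_poly_cnj_mult
  map_poly_cnj_pderiv map_poly_pCons

text \<open>The variable is real, so conjugation touches coefficients only, and evaluation at real
  points gives the conjugate transpose.\<close>

definition mpoly_star :: "mpoly2 \<Rightarrow> mpoly2" where
  "mpoly_star P = (\<chi> i j. map_poly cnj (P $ j $ i))"

lemma mpoly_star_mult: "mpoly_star (P ** Q) = mpoly_star Q ** mpoly_star P"
  by (simp add: mpoly_star_def vec_eq_iff matrix_matrix_mult_def sum_2 map_poly_cnj_simps mult.commute)

lemma mpoly_star_mpoly_star [simp]: "mpoly_star (mpoly_star P) = P"
  by (simp add: mpoly_star_def vec_eq_iff)

lemma mpoly_eval_mult: "mpoly_eval (P ** Q) x = mpoly_eval P x ** mpoly_eval Q x"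
  by (simp add: mpoly_eval_def vec_eq_iff matrix_matrix_mult_def sum_2)

lemma mpoly_eval_star: "mpoly_eval (mpoly_star P) x = ctranspose (mpoly_eval P x)"
  by (simp add: mpoly_eval_def mpoly_star_def ctranspose_def vec_eq_iff)

lemma integral_mat2_component:
  fixes f :: "'a \<Rightarrow> mat2"
  assumes "\<And>i j. integrable M (\<lambda>x. f x $ i $ j)"
  shows "integral\<^sup>L M f $ i $ j = (LINT x|M. f x $ i $ j)"
proof -
  let ?e = "\<lambda>i j c. axis i (axis j c) :: mat2"
  have "bounded_linear (?e i j)" for i j
    unfolding linear_conv_bounded_linear[symmetric]
    by (rule linearI) (simp_all add: vec_eq_iff axis_def)
  then have int: "integrable M (\<lambda>x. ?e i j (f x $ i $ j))" for i j
    using assms by (rule integrable_bounded_linear)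
  have eq: "f = (\<lambda>x. ?e 1 1 (f x $ 1 $ 1) + ?e 1 2 (f x $ 1 $ 2)
                  + ?e 2 1 (f x $ 2 $ 1) + ?e 2 2 (f x $ 2 $ 2))"
    by (rule ext) (simp add: vec_eq_iff axis_def forall_2)
  have "integrable M f"
    by (subst eq) (intro Bochner_Integration.integrable_add int)
  from integral_bounded_linear[OF bounded_linear_compose[OF bounded_linear_vec_nth bounded_linear_vec_nth] this]
  show ?thesis by simp
qed

lemma set_integrable_density_poly:
  fixes \<phi> :: "real \<Rightarrow> real"
  assumes "\<And>k. set_integrable lborel I (\<lambda>x. \<phi> x * x ^ k)"
  shows "set_integrable lborel I (\<lambda>x. complex_of_real (\<phi> x) * poly f (complex_of_real x))"
proof -
  have "integrable lborel (\<lambda>x. complex_of_real (indicator I x * (\<phi> x * x ^ i)))" for i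
    using assms[of i] unfolding complex_of_real_integrable_eq set_integrable_def by simp
  then have "integrable lborel (\<lambda>x. \<Sum>i\<le>degree f. coeff f i * complex_of_real (indicator I x * (\<phi> x * x ^ i)))"
    by (intro Bochner_Integration.integrable_sum integrable_mult_right)
  moreover have "(\<Sum>i\<le>degree f. coeff f i * complex_of_real (indicator I x * (\<phi> x * x ^ i))) =
      indicator I x *\<^sub>R (complex_of_real (\<phi> x) * poly f (complex_of_real x))" for x
    by (simp add: poly_altdef sum_distrib_left mult_ac scaleR_conv_of_real)
  ultimately show ?thesis by (simp add: set_integrable_def)
qed

text \<open>The factorization through \<open>T\<close> and a positive diagonal matrix makes
  definiteness a statement about sums of squares. \<open>T\<close> need only be cancellable, not
  invertible over the polynomials. \<open>pearson\<close> is the integrated form of (\<phi>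
  \<sigma>)' = \<phi> \<tau>, with the boundary terms already gone.\<close>

locale polynomial_weight =
  fixes I :: "real set" and W :: "real \<Rightarrow> mat2" and \<phi> :: "real \<Rightarrow> real"
    and \<sigma> \<tau> :: "complex poly" and T :: mpoly2 and d :: "2 \<Rightarrow> real"
  assumes I_borel [measurable]: "I \<in> sets lborel"
    and I_nonnull: "emeasure lborel I \<noteq> 0"
    and density_pos: "x \<in> I \<Longrightarrow> 0 < \<phi> x"
    and density_moments: "set_integrable lborel I (\<lambda>x. \<phi> x * x ^ k)"
    and pearson: "(LINT x:I|lborel. complex_of_real (\<phi> x) * poly (\<sigma> * pderiv f + \<tau> * f) (complex_of_real x)) = 0"
    and weight: "x \<in> I \<Longrightarrow>
      W x = \<phi> x *\<^sub>R mpoly_eval (T ** (\<chi> i j. if i = j then [:complex_of_real (d i):] else 0) ** mpoly_star T) x"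
    and T_cancel: "P ** T = 0 \<Longrightarrow> P = (0 :: mpoly2)"
    and d_pos: "0 < d i"
begin

definition V :: mpoly2 where
  "V = T ** (\<chi> i j. if i = j then [:complex_of_real (d i):] else 0) ** mpoly_star T"

text \<open>The scalar moment functional. The matrix form becomes \<open>L\<close> applied entrywise
  to polynomials, which removes integrals from the later arguments.\<close>

definition L :: "complex poly \<Rightarrow> complex" where
  "L f = (LINT x:I|lborel. complex_of_real (\<phi> x) * poly f (complex_of_real x))"

lemmas integrable_density_poly = set_integrable_density_poly[OF density_moments]

lemma L_add: "L (f + g) = L f + L g"
  unfolding L_def poly_add distrib_left
  by (intro set_integral_add(2) integrable_density_poly)

lemma L_smult: "L (smult c f) = c * L f"
  by (simp add: L_def mult.left_commute)

lemma L_diff: "L (f - g) = L f - L g"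
  using L_add[of "f - g" g] by simp

lemma L_cnj: "L (map_poly cnj f) = cnj (L f)"
proof -
  have "cnj (L f) = (LINT x|lborel. cnj (indicator I x *\<^sub>R (complex_of_real (\<phi> x) * poly f (complex_of_real x))))"
    unfolding L_def set_lebesgue_integral_def by (rule Bochner_Integration.integral_cnj[symmetric])
  then show ?thesis by (simp add: L_def set_lebesgue_integral_def)
qed

text \<open>If the integral of a nonnegative function vanishes, the integrand is zero almost
  everywhere; a nonzero polynomial has finitely many roots, so \<open>I\<close> would be a null
  set.\<close>

lemma L_norm_square:
  obtains r where "L (f * map_poly cnj f) = complex_of_real r" "0 \<le> r" "r = 0 \<longrightarrow> f = 0"
proof -
  let ?g = "\<lambda>x. indicator I x * (\<phi> x * (cmod (poly f (complex_of_real x)))\<^sup>2)"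
  define r where "r = (LINT x|lborel. ?g x)"
  have eq: "indicator I x *\<^sub>R (complex_of_real (\<phi> x) * poly (f * map_poly cnj f) (complex_of_real x))
      = complex_of_real (?g x)" for x
    by (simp add: complex_norm_square[symmetric] scaleR_conv_of_real)
  have int: "integrable lborel ?g"
    using integrable_density_poly[of "f * map_poly cnj f"]
    unfolding set_integrable_def eq complex_of_real_integrable_eq .
  have nonneg: "0 \<le> ?g x" for x
    using density_pos[of x] by (cases "x \<in> I") simp_all
  have "L (f * map_poly cnj f) = complex_of_real r"
    unfolding L_def set_lebesgue_integral_def eq r_def by (rule integral_complex_of_real)
  moreover have "0 \<le> r"
    unfolding r_def using nonneg by simp
  moreover have "f = 0" if "r = 0"
  proof (rule ccontr)
    assume "f \<noteq> 0"
    then have "finite {z. poly f z = 0}" by (rule poly_roots_finite)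
    then have "finite (complex_of_real -` {z. poly f z = 0})"
      by (rule finite_vimageI) (simp add: inj_on_def)
    then have "AE x in lborel. x \<notin> complex_of_real -` {z. poly f z = 0}"
      by (intro AE_not_in finite_imp_null_set_lborel)
    moreover have "AE x in lborel. ?g x = 0"
      using that integral_nonneg_eq_0_iff_AE[OF int] nonneg by (simp add: r_def)
    ultimately have "AE x in lborel. x \<notin> I"
    proof eventually_elim
      case (elim x)
      then show ?case using density_pos[of x] by (auto simp: indicator_def split: if_splits)
    qed
    then have "I \<in> null_sets lborel"
      using AE_iff_null_sets[OF I_borel] by blast
    then show False using I_nonnull by (simp add: null_sets_def)
  qed
  ultimately show thesis using that by blast
qed

lemma mform_eq: "mform I W P Q = map_matrix L (P ** V ** mpoly_star Q)"
proof -
  let ?f = "\<lambda>x. indicator I x *\<^sub>R (mpoly_eval P x ** W x ** ctranspose (mpoly_eval Q x))"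
  have comp: "?f x $ i $ j = indicator I x *\<^sub>R
      (complex_of_real (\<phi> x) * poly ((P ** V ** mpoly_star Q) $ i $ j) (complex_of_real x))" for x i j
  proof (cases "x \<in> I")
    case True
    have scale: "A ** (c *\<^sub>R B) ** C = c *\<^sub>R (A ** B ** C)" for A B C :: mat2 and c
      by (simp add: vec_eq_iff matrix_matrix_mult_def sum_2 algebra_simps)
    have "?f x = \<phi> x *\<^sub>R mpoly_eval (P ** V ** mpoly_star Q) x"
      using True by (simp add: weight V_def[symmetric] mpoly_eval_mult mpoly_eval_star scale)
    then have "?f x $ i $ j = (\<phi> x *\<^sub>R mpoly_eval (P ** V ** mpoly_star Q) x) $ i $ j" by simp
    then show ?thesis using True by (simp add: mpoly_eval_def scaleR_conv_of_real[where 'a=complex])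
  qed simp
  have "integral\<^sup>L lborel ?f $ i $ j = L ((P ** V ** mpoly_star Q) $ i $ j)" for i j
    unfolding L_def set_lebesgue_integral_def comp[symmetric]
    using integrable_density_poly
    by (intro integral_mat2_component) (simp only: comp set_integrable_def)
  then show ?thesis
    by (simp add: mform_def set_lebesgue_integral_def vec_eq_iff)
qed

lemma mform_component: "mform I W P Q $ i $ j = L ((P ** V ** mpoly_star Q) $ i $ j)"
  by (simp add: mform_eq)

lemma V_star: "mpoly_star V = V"
proof -
  have "mpoly_star (\<chi> i j. if i = j then [:complex_of_real (d i):] else 0) =
      (\<chi> i j. if i = j then [:complex_of_real (d i):] else 0)"
    by (simp add: mpoly_star_def vec_eq_iff map_poly_pCons)
  then show ?thesis
    by (simp add: V_def mpoly_star_mult matrix_mul_assoc)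
qed

sublocale matrix_form I W
proof
  show "mform I W (P + Q) R = mform I W P R + mform I W Q R" for P Q R
    by (simp add: mform_eq matrix_add_rdistrib vec_eq_iff L_add)
  show "mform I W (mpoly_const A ** P) Q = A ** mform I W P Q" for A P Q
    unfolding mform_eq matrix_mul_assoc[symmetric, of "mpoly_const A"]
    by (simp add: vec_eq_iff matrix_matrix_mult_def[of _ "_ ** _"] matrix_matrix_mult_def[of A]
        mpoly_const_def sum_2 L_add L_smult)
  show "mform I W Q P = ctranspose (mform I W P Q)" for P Q
  proof -
    have "Q ** V ** mpoly_star P = mpoly_star (P ** V ** mpoly_star Q)"
      by (simp add: mpoly_star_mult V_star matrix_mul_assoc)
    then show ?thesis
      by (simp add: mform_eq vec_eq_iff ctranspose_def mpoly_star_def[of "P ** V ** _"] L_cnj)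
  qed
  show "P = 0" if zero: "mform I W P P = 0" for P
  proof -
    \<comment> \<open>In terms of PT the weight is diagonal: the i-th diagonal entry of (P,P) is a
      sum, with weights \<open>d\<close>, of squared norms of the entries in row i of
      \<open>R\<close>.\<close>
    define R where "R = P ** T"
    have "P ** V ** mpoly_star P = R ** (\<chi> i j. if i = j then [:complex_of_real (d i):] else 0) ** mpoly_star R"
      by (simp add: R_def V_def mpoly_star_mult matrix_mul_assoc)
    then have "mform I W P P $ i $ i =
        complex_of_real (d 1) * L (R$i$1 * map_poly cnj (R$i$1))
        + complex_of_real (d 2) * L (R$i$2 * map_poly cnj (R$i$2))" for i
      by (simp add: mform_component matrix_matrix_mult_def sum_2 mpoly_star_def L_add L_smult)
    then have *: "complex_of_real (d 1) * L (R$i$1 * map_poly cnj (R$i$1))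
        + complex_of_real (d 2) * L (R$i$2 * map_poly cnj (R$i$2)) = 0" for i
      using zero by simp
    have "R$i$1 = 0 \<and> R$i$2 = 0" for i
    proof -
      obtain r1 where r1: "L (R$i$1 * map_poly cnj (R$i$1)) = complex_of_real r1" "0 \<le> r1"
        "r1 = 0 \<longrightarrow> R$i$1 = 0" by (rule L_norm_square[of "R$i$1"])
      obtain r2 where r2: "L (R$i$2 * map_poly cnj (R$i$2)) = complex_of_real r2" "0 \<le> r2"
        "r2 = 0 \<longrightarrow> R$i$2 = 0" by (rule L_norm_square[of "R$i$2"])
      have "complex_of_real (d 1 * r1 + d 2 * r2) = 0"
        using *[of i] by (simp add: r1(1) r2(1))
      then have "d 1 * r1 + d 2 * r2 = 0" unfolding of_real_eq_0_iff .
      moreover have "0 \<le> d 1 * r1" "0 \<le> d 2 * r2"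
        using d_pos[of 1] d_pos[of 2] r1(2) r2(2) by simp_all
      ultimately have "d 1 * r1 = 0" "d 2 * r2 = 0" by linarith+
      then show ?thesis using d_pos[of 1] d_pos[of 2] r1(3) r2(3) by auto
    qed
    then have "P ** T = 0" by (simp add: R_def[symmetric] vec_eq_iff forall_2)
    then show ?thesis by (rule T_cancel)
  qed
qed

text \<open>Symmetry is witnessed by a bilinear concomitant, which the Pearson equation annihilates.\<close>
lemma symmetricI:
  assumes "\<And>i j. \<exists>G. (S P ** V ** mpoly_star Q) $ i $ j - (P ** V ** mpoly_star (S Q)) $ i $ j
             = \<sigma> * pderiv G + \<tau> * G"
  shows "mform I W (S P) Q = mform I W P (S Q)"
proof -
  have "L ((S P ** V ** mpoly_star Q) $ i $ j) - L ((P ** V ** mpoly_star (S Q)) $ i $ j) = 0" for i j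
    unfolding L_diff[symmetric] using assms[of i j] pearson by (auto simp: L_def simp del: poly_add poly_diff)
  then show ?thesis by (simp add: vec_eq_iff mform_component)
qed

end


subsection \<open>The two symmetric operators\<close>

text \<open>
  Substituting \<open>P T = R\<close> with \<open>T = e\<^sup>t\<^sup>M\<close> turns the second weight into the scalar Hermite weight. On \<open>R\<close>
  the operator is \<open>(-B, 1 - a\<^sup>2N\<^sup>2; 1 - (cnj a)\<^sup>2 \<partial>\<^sup>2 / 4, B)\<close> with \<open>N = t - \<partial>/2\<close> and
  \<open>B = cnj a \<partial>/2 + a N\<close>, which is symmetric because \<open>\<partial>\<^sup>* = 2N\<close>. Transported back to \<open>P\<close>, its two
  columns are \<open>hermite1\<close> and \<open>hermite2\<close>, with \<open>A = a/2\<close> and \<open>C = cnj a/2\<close>.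
\<close>
definition hermite1 :: "complex poly \<Rightarrow> complex poly \<Rightarrow> complex poly \<Rightarrow> complex poly \<Rightarrow> complex poly \<Rightarrow> complex poly" where
  "hermite1 x A C y1 y2 = y2 - C * C * pderiv (pderiv y2) - 2 * A * C * C * (x * pderiv (pderiv y1))
     + (A - C - 4 * A * C * C) * pderiv y1"

definition hermite2 :: "complex poly \<Rightarrow> complex poly \<Rightarrow> complex poly \<Rightarrow> complex poly \<Rightarrow> complex poly \<Rightarrow> complex poly" where
  "hermite2 x A C y1 y2 = 4 * A * A * C * C * (x * (x * pderiv (pderiv y1))) - A * A * pderiv (pderiv y1)
     + 2 * A * C * C * (x * pderiv (pderiv y2))
     + (4 * A * C + 8 * A * A * C * C) * (x * pderiv y1) + (C - A) * pderiv y2 + (1 + 2 * A * C) * y1"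

text \<open>The \<open>y\<close> are a row of P and the \<open>z\<close> a conjugated row of Q;
  conjugation exchanges \<open>A\<close> and \<open>C\<close>, whence the swapped parameters on the
  \<open>z\<close> side.\<close>

lemma hermite_concomitant:
  fixes x y1 y2 z1 z2 :: "complex poly"
  assumes "pderiv x = 1" "pderiv A = 0" "pderiv C = 0"
  shows "\<exists>G. hermite1 x A C y1 y2 * ((1 + 4*A*C*x*x) * z1 + 2*A*x*z2) + hermite2 x A C y1 y2 * (2*C*x*z1 + z2)
     - (((1 + 4*A*C*x*x) * y1 + 2*C*x*y2) * hermite1 x C A z1 z2 + (2*A*x*y1 + y2) * hermite2 x C A z1 z2)
     = 1 * pderiv G + (- 2 * x) * G"
proof -
  \<comment> \<open>The Lagrange concomitant. With F_1, F_2 the coefficients of the operator, the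
    first two lines are y' F_2 V z - y F_2 V z', and the last is y K z with K = (F_1 W - (F_2 W)') /
    \<phi>.\<close>
  let ?G = " pderiv y1 * (- 2*A*C*(A+C)*x * z1 - A*A * z2) - pderiv y2 * (C*C*z1)
     - y1 * (- 2*A*C*(A+C)*x * pderiv z1 - A*A * pderiv z2) + y2 * (C*C*pderiv z1)
     - y1 * ((C-A)*(1+2*A*C) * z1 - 2*A*C*x * z2) - y2 * (2*A*C*x*z1 + (A-C)*z2)"
  have [simp]: "pderiv (2 :: complex poly) = 0" "pderiv (4 :: complex poly) = 0" "pderiv (8 :: complex poly) = 0"
    by (simp_all add: numeral_poly)
  show ?thesis
    unfolding hermite1_def hermite2_def
    by (rule exI[of _ ?G], simp add: pderiv_add pderiv_diff pderiv_mult pderiv_minus assms(1-3), algebra)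
qed

text \<open>
  Here \<open>q = n - p\<close>. The second column is the first one with \<open>p, q\<close> and the two
  components of the row exchanged, a symmetry of the weight itself.
\<close>
definition gegenbauer1 :: "complex poly \<Rightarrow> complex poly \<Rightarrow> complex poly \<Rightarrow> complex poly \<Rightarrow> complex poly \<Rightarrow> complex poly" where
  "gegenbauer1 x p q y1 y2 = (p - q) * (x * pderiv (pderiv y1)) + q * (x * (x * pderiv (pderiv y2)))
     - p * pderiv (pderiv y2)
     + 2 * p * pderiv y1 + 2 * q * (p + 1) * (x * pderiv y2) + p * q * (p + 1) * y2"

lemma gegenbauer_concomitant:
  fixes x y1 y2 z1 z2 :: "complex poly"
  assumes "pderiv x = 1" "pderiv p = 0" "pderiv q = 0"
  shows "\<exists>G. gegenbauer1 x p q y1 y2 * ((p*x*x+q) * z1 - (p+q)*x*z2) + gegenbauer1 x q p y2 y1 * ((q*x*x+p)*z2 - (p+q)*x*z1)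
     - (((p*x*x+q) * y1 - (p+q)*x*y2) * gegenbauer1 x p q z1 z2 + ((q*x*x+p)*y2 - (p+q)*x*y1) * gegenbauer1 x q p z2 z1)
     = (1 - x * x) * pderiv G + (- (p + q) * x) * G"
proof -
  \<comment> \<open>Again the Lagrange concomitant, now divided by \<sigma> = 1 - x^2. The division
    is exact: F_2 V is p q (1 - x^2) times the matrix with diagonal 2x and off-diagonal -(1 +
    x^2).\<close>
  let ?G = " p * q * (pderiv y1 * (2*x*z1 - (1+x*x)*z2) + pderiv y2 * (2*x*z2 - (1+x*x)*z1)
     - y1 * (2*x*pderiv z1 - (1+x*x)*pderiv z2) - y2 * (2*x*pderiv z2 - (1+x*x)*pderiv z1)
     - (q - p) * x * (y1 * z2 - y2 * z1))"
  have [simp]: "pderiv (2 :: complex poly) = 0"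
    by (simp_all add: numeral_poly)
  show ?thesis
    unfolding gegenbauer1_def
    by (rule exI[of _ ?G], simp add: pderiv_add pderiv_diff pderiv_mult pderiv_minus assms(1-3), algebra)
qed

section \<open>Action of the two operators on leading coefficients\<close>

lemma coeff_x_pderiv: "coeff (pCons 0 (pderiv p)) k = of_nat k * coeff p k"
  by (cases k) (simp_all add: coeff_pderiv)

lemma coeff_x_pderiv2:
  "coeff (pCons 0 (pderiv (pderiv p))) k = of_nat k * of_nat (Suc k) * coeff p (Suc k)"
  by (cases k) (simp_all add: coeff_pderiv algebra_simps)

lemma coeff_x2_pderiv2:
  "coeff (pCons 0 (pCons 0 (pderiv (pderiv p)))) k = of_nat k * (of_nat k - 1) * coeff p k"
  for p :: "complex poly"
proof (cases k)
  case (Suc m)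
  then show ?thesis by (cases m) (simp_all add: coeff_pderiv)
qed simp

lemma coeff_pCons_0_add:
  "coeff (pCons 0 (p + q)) k = coeff (pCons 0 p) k + coeff (pCons 0 q) k"
  by (cases k) simp_all

lemma coeff_pCons_0_smult:
  "coeff (pCons 0 (smult c p)) k = c * coeff (pCons 0 p) k"
  "coeff (pCons 0 (pCons 0 (smult c p))) k = c * coeff (pCons 0 (pCons 0 p)) k"
  by (auto simp: coeff_pCons split: nat.splits)

lemmas coeff_leading_simps = numeral_poly one_pCons coeff_pCons_0_add coeff_pCons_0_smult
  coeff_x_pderiv coeff_x_pderiv2 coeff_x2_pderiv2 coeff_pderiv

text \<open>Only multiples of y, x y' and x^2 y'' keep the degree, contributing 1, k and k(k-1); all
  remaining terms lower it. In the second column the resulting quadratic in k factors.\<close>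

lemma hermite_leading:
  assumes "\<And>m. k < m \<Longrightarrow> coeff y1 m = 0" "\<And>m. k < m \<Longrightarrow> coeff y2 m = 0"
  shows "coeff (hermite1 [:0, 1:] [:\<alpha>:] [:\<gamma>:] y1 y2) k = coeff y2 k"
    and "coeff (hermite2 [:0, 1:] [:\<alpha>:] [:\<gamma>:] y1 y2) k =
      (1 + 2 * \<alpha> * \<gamma> * of_nat k) * (1 + 2 * \<alpha> * \<gamma> * of_nat (Suc k)) * coeff y1 k"
  using assms
  by (simp_all add: hermite1_def hermite2_def coeff_leading_simps) (simp add: algebra_simps)

lemma gegenbauer_leading:
  assumes "\<And>m. k < m \<Longrightarrow> coeff y1 m = 0" "\<And>m. k < m \<Longrightarrow> coeff y2 m = 0"
  shows "coeff (gegenbauer1 [:0, 1:] [:p:] [:q:] y1 y2) k =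
      q * (of_nat k + p) * (of_nat k + p + 1) * coeff y2 k"
  using assms
  by (simp add: gegenbauer1_def coeff_leading_simps) (simp add: algebra_simps)

lemma diff_op_2_component:
  "diff_op 2 F P $ i $ j =
     P$i$1 * F 0 $1$j + P$i$2 * F 0 $2$j + pderiv (P$i$1) * F 1 $1$j + pderiv (P$i$2) * F 1 $2$j
     + pderiv (pderiv (P$i$1)) * F 2 $1$j + pderiv (pderiv (P$i$2)) * F 2 $2$j"
  by (simp add: diff_op_def numeral_2_eq_2 matrix_matrix_mult_def sum_2)


subsection \<open>The scalar densities\<close>

text \<open>The integrand is the derivative of \<Phi> f, where \<Phi> = \<phi> \<sigma> and \<psi> =
  \<phi> \<tau> are kept as real functions so that real differentiation applies; the limits at both
  ends are zero.\<close>

lemma pearson_integral: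
  fixes \<phi> \<Phi> \<psi> :: "real \<Rightarrow> real" and \<sigma> \<tau> f :: "complex poly" and a b :: ereal
  assumes "a < b"
    and deriv: "\<And>x. a < ereal x \<Longrightarrow> ereal x < b \<Longrightarrow> (\<Phi> has_real_derivative \<psi> x) (at x)"
    and \<psi>: "\<And>x. a < ereal x \<Longrightarrow> ereal x < b \<Longrightarrow>
      complex_of_real (\<psi> x) = complex_of_real (\<phi> x) * poly \<tau> (complex_of_real x)"
    and \<Phi>: "\<And>x. a < ereal x \<Longrightarrow> ereal x < b \<Longrightarrow>
      complex_of_real (\<Phi> x) = complex_of_real (\<phi> x) * poly \<sigma> (complex_of_real x)"
    and cont: "\<And>x. a < ereal x \<Longrightarrow> ereal x < b \<Longrightarrow> isCont \<phi> x"
    and moments: "\<And>k. set_integrable lborel (einterval a b) (\<lambda>x. \<phi> x * x ^ k)"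
    and lim_a: "(((\<lambda>x. complex_of_real (\<Phi> x) * poly f (complex_of_real x)) \<circ> real_of_ereal) \<longlongrightarrow> 0) (at_right a)"
    and lim_b: "(((\<lambda>x. complex_of_real (\<Phi> x) * poly f (complex_of_real x)) \<circ> real_of_ereal) \<longlongrightarrow> 0) (at_left b)"
  shows "(LINT x:einterval a b|lborel.
      complex_of_real (\<phi> x) * poly (\<sigma> * pderiv f + \<tau> * f) (complex_of_real x)) = 0"
proof -
  have D: "((\<lambda>x. complex_of_real (\<Phi> x) * poly f (complex_of_real x)) has_vector_derivative
      complex_of_real (\<phi> x) * poly (\<sigma> * pderiv f + \<tau> * f) (complex_of_real x)) (at x)"
    if "a < ereal x" "ereal x < b" for x
  proof -
    have "((\<lambda>x. complex_of_real (\<Phi> x) * poly f (complex_of_real x)) has_vector_derivative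
        complex_of_real (\<Phi> x) * poly (pderiv f) (complex_of_real x)
        + complex_of_real (\<psi> x) * poly f (complex_of_real x)) (at x)"
      by (intro has_vector_derivative_mult has_vector_derivative_of_real deriv that
          has_vector_derivative_real_field poly_DERIV)
    then show ?thesis by (simp add: \<psi> \<Phi> that algebra_simps)
  qed
  have "(LBINT x=a..b. complex_of_real (\<phi> x) * poly (\<sigma> * pderiv f + \<tau> * f) (complex_of_real x)) = 0 - 0"
    by (rule interval_integral_FTC_integrable[OF \<open>a < b\<close> D _ _ lim_a lim_b])
       (auto intro!: set_integrable_density_poly[OF moments] continuous_intros cont simp del: poly_add)
  then show ?thesis
    using \<open>a < b\<close> by (simp add: interval_lebesgue_integral_le_eq)
qed

lemma hermite_moments: "set_integrable lborel UNIV (\<lambda>x::real. exp (- x\<^sup>2) * x ^ k)"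
proof -
  \<comment> \<open>The normal density of variance 1/2 is exp(-x^2) divided by the square root of
    pi.\<close>
  have "integrable lborel (\<lambda>x. sqrt pi * (normal_density 0 (1 / sqrt 2) x * (x - 0) ^ k))"
    by (intro integrable_mult_right integrable_normal_moment) simp
  then show ?thesis
    by (simp add: normal_density_def set_integrable_def power_divide mult.assoc)
qed

lemma tendsto_exp_minus_square_poly:
  assumes "F = at_top \<or> F = at_bot"
  shows "((\<lambda>x. complex_of_real (exp (- x\<^sup>2)) * poly f (complex_of_real x)) \<longlongrightarrow> 0) F"
proof -
  have "((\<lambda>x::real. exp (- x\<^sup>2) * x ^ k) \<longlongrightarrow> 0) at_top" for k
    by real_asymp
  moreover have "((\<lambda>x::real. exp (- x\<^sup>2) * x ^ k) \<longlongrightarrow> 0) at_bot" for k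
    by real_asymp
  ultimately have "((\<lambda>x::real. exp (- x\<^sup>2) * x ^ k) \<longlongrightarrow> 0) F" for k
    using assms by auto
  then have "((\<lambda>x. \<Sum>i\<le>degree f. coeff f i * complex_of_real (exp (- x\<^sup>2) * x ^ i)) \<longlongrightarrow>
      (\<Sum>i\<le>degree f. coeff f i * complex_of_real 0)) F"
    by (intro tendsto_intros)
  then show ?thesis
    by (simp add: poly_altdef sum_distrib_left mult_ac)
qed

lemma hermite_pearson:
  "(LINT x:UNIV|lborel. complex_of_real (exp (- x\<^sup>2)) *
      poly (1 * pderiv f + [:0, -2:] * f) (complex_of_real x)) = 0"
proof -
  have "(LINT x:einterval (-\<infinity>) \<infinity>|lborel. complex_of_real (exp (- x\<^sup>2)) *
      poly (1 * pderiv f + [:0, -2:] * f) (complex_of_real x)) = 0"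
    by (rule pearson_integral[where \<Phi> = "\<lambda>x. exp (- x\<^sup>2)" and \<psi> = "\<lambda>x. exp (- x\<^sup>2) * (- 2 * x)"])
       (auto simp: hermite_moments ereal_tendsto_simps intro!: tendsto_exp_minus_square_poly
          derivative_eq_intros continuous_intros)
  then show ?thesis by simp
qed

text \<open>Only one endpoint can be singular at a time: for a < 1 the factor belonging to the
  farther endpoint is at most 1, so the density is bounded by a one-sided power, which has an
  explicit primitive with finite limits. For a \<ge> 1 the constant 1 dominates.\<close>

lemma gegenbauer_density_integrable:
  fixes a :: real
  assumes "0 < a"
  shows "set_integrable lborel {-1<..<1} (\<lambda>x. (1 - x\<^sup>2) powr (a - 1))"
proof -
  have 1: "set_integrable lborel {-1<..<1} (\<lambda>x. (1 - x) powr (a - 1))"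
  proof -
    have "set_integrable lborel (einterval (ereal (-1)) (ereal 1)) (\<lambda>x. (1 - x) powr (a - 1))"
    proof (rule interval_integral_FTC_nonneg(1)[where F = "\<lambda>x. - ((1 - x) powr a / a)"])
      show "((\<lambda>x. - ((1 - x) powr a / a)) has_real_derivative (1 - x) powr (a - 1)) (at x)"
        if "ereal (-1) < ereal x" "ereal x < ereal 1" for x
        using that assms by (auto intro!: derivative_eq_intros simp: powr_diff)
      show "(((\<lambda>x. - ((1 - x) powr a / a)) \<circ> real_of_ereal) \<longlongrightarrow> - (2 powr a / a)) (at_right (ereal (-1)))"
        unfolding ereal_tendsto_simps using assms
        by (auto intro!: tendsto_eq_intros)
      show "(((\<lambda>x. - ((1 - x) powr a / a)) \<circ> real_of_ereal) \<longlongrightarrow> 0) (at_left (ereal 1))"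
        unfolding ereal_tendsto_simps using assms
        by (auto intro!: tendsto_eq_intros eventually_at_leftI[of 0])
    qed (auto intro!: continuous_intros)
    then show ?thesis by simp
  qed
  have 2: "set_integrable lborel {-1<..<1} (\<lambda>x. (1 + x) powr (a - 1))"
  proof -
    have "set_integrable lborel (einterval (ereal (-1)) (ereal 1)) (\<lambda>x. (1 + x) powr (a - 1))"
    proof (rule interval_integral_FTC_nonneg(1)[where F = "\<lambda>x. (1 + x) powr a / a"])
      show "((\<lambda>x. (1 + x) powr a / a) has_real_derivative (1 + x) powr (a - 1)) (at x)"
        if "ereal (-1) < ereal x" "ereal x < ereal 1" for x
        using that assms by (auto intro!: derivative_eq_intros simp: powr_diff)
      show "(((\<lambda>x. (1 + x) powr a / a) \<circ> real_of_ereal) \<longlongrightarrow> 0) (at_right (ereal (-1)))"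
        unfolding ereal_tendsto_simps using assms
        by (auto intro!: tendsto_eq_intros eventually_at_rightI[of "-1" 0])
      show "(((\<lambda>x. (1 + x) powr a / a) \<circ> real_of_ereal) \<longlongrightarrow> 2 powr a / a) (at_left (ereal 1))"
        unfolding ereal_tendsto_simps using assms
        by (auto intro!: tendsto_eq_intros)
    qed (auto intro!: continuous_intros)
    then show ?thesis by simp
  qed
  have 3: "set_integrable lborel {-1<..<1::real} (\<lambda>x. 1 :: real)"
    by (simp add: set_integrable_def)
  have bound: "(1 - x\<^sup>2) powr (a - 1) \<le> 1 + ((1 - x) powr (a - 1) + (1 + x) powr (a - 1))"
    if "x \<in> {-1<..<1}" for x
  proof -
    have x: "0 < 1 - x" "0 < 1 + x" using that by auto
    have eq: "(1 - x\<^sup>2) powr (a - 1) = (1 - x) powr (a - 1) * (1 + x) powr (a - 1)"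
      using x by (simp add: powr_mult[symmetric] power2_eq_square algebra_simps)
    consider "1 \<le> a" | "a < 1" "0 \<le> x" | "a < 1" "x < 0" by linarith
    then show ?thesis
    proof cases
      case 1
      have "(1 - x\<^sup>2) powr (a - 1) \<le> 1"
        using 1 that by (intro powr_le1) (auto simp: abs_square_le_1 abs_le_iff)
      then show ?thesis by (simp add: add_increasing2)
    next
      case 2
      then have "(1 + x) powr (a - 1) \<le> 1" using powr_mono[of "a - 1" 0 "1 + x"] by simp
      then have "(1 - x\<^sup>2) powr (a - 1) \<le> (1 - x) powr (a - 1)"
        unfolding eq by (simp add: mult_left_le)
      then show ?thesis by (simp add: add_increasing add_increasing2)
    next
      case 3
      then have "(1 - x) powr (a - 1) \<le> 1" using powr_mono[of "a - 1" 0 "1 - x"] by simp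
      then have "(1 - x\<^sup>2) powr (a - 1) \<le> (1 + x) powr (a - 1)"
        unfolding eq by (simp add: mult_left_le_one_le)
      then show ?thesis by (simp add: add_increasing add_increasing2)
    qed
  qed
  show ?thesis
  proof (rule set_integrable_bound[OF set_integral_add(1)[OF 3 set_integral_add(1)[OF 1 2]]])
    show "set_borel_measurable lborel {-1<..<1} (\<lambda>x. (1 - x\<^sup>2) powr (a - 1))"
      by (simp add: set_borel_measurable_def)
    show "AE x in lborel. x \<in> {-1<..<1} \<longrightarrow> norm ((1 - x\<^sup>2) powr (a - 1))
        \<le> norm (1 + ((1 - x) powr (a - 1) + (1 + x) powr (a - 1)))"
      using bound by (intro AE_I2) simp
  qed
qed

lemma gegenbauer_moments:
  fixes a :: real
  assumes "0 < a"
  shows "set_integrable lborel {-1<..<1} (\<lambda>x. (1 - x\<^sup>2) powr (a - 1) * x ^ k)"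
proof (rule set_integrable_bound[OF gegenbauer_density_integrable[OF assms]])
  show "AE x in lborel. x \<in> {-1<..<1} \<longrightarrow>
      norm ((1 - x\<^sup>2) powr (a - 1) * x ^ k) \<le> norm ((1 - x\<^sup>2) powr (a - 1))"
    by (intro AE_I2) (auto simp: abs_mult power_abs intro!: mult_left_le power_le_one)
qed (simp add: set_borel_measurable_def)

text \<open>Multiplying the density by 1 - x^2 raises the exponent to \<open>a\<close>, which is
  positive, so the boundary terms vanish at both endpoints.\<close>

lemma gegenbauer_pearson:
  fixes a :: real
  assumes "0 < a"
  shows "(LINT x:{-1<..<1}|lborel. complex_of_real ((1 - x\<^sup>2) powr (a - 1)) *
      poly ([:1, 0, -1:] * pderiv f + [:0, - complex_of_real (2 * a):] * f) (complex_of_real x)) = 0"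
proof -
  have pos: "0 < 1 - x\<^sup>2" if "ereal (-1) < ereal x" "ereal x < ereal 1" for x
    using that by (simp add: abs_square_less_1 abs_less_iff)
  have "(LINT x:einterval (ereal (-1)) (ereal 1)|lborel. complex_of_real ((1 - x\<^sup>2) powr (a - 1)) *
      poly ([:1, 0, -1:] * pderiv f + [:0, - complex_of_real (2 * a):] * f) (complex_of_real x)) = 0"
  proof (rule pearson_integral[where \<Phi> = "\<lambda>x. (1 - x\<^sup>2) powr a"
        and \<psi> = "\<lambda>x. (1 - x\<^sup>2) powr (a - 1) * (- 2 * a * x)"])
    fix x :: real
    assume x: "ereal (-1) < ereal x" "ereal x < ereal 1"
    show "((\<lambda>x. (1 - x\<^sup>2) powr a) has_real_derivative (1 - x\<^sup>2) powr (a - 1) * (- 2 * a * x)) (at x)"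
      using pos[OF x] by (auto intro!: derivative_eq_intros simp: powr_diff)
    have "(1 - x\<^sup>2) powr a = (1 - x\<^sup>2) powr (a - 1) * (1 - x\<^sup>2)"
      using pos[OF x] by (simp add: powr_diff)
    then show "complex_of_real ((1 - x\<^sup>2) powr a) =
        complex_of_real ((1 - x\<^sup>2) powr (a - 1)) * poly [:1, 0, -1:] (complex_of_real x)"
      by (simp add: power2_eq_square)
    show "isCont (\<lambda>x. (1 - x\<^sup>2) powr (a - 1)) x"
      using pos[OF x] by (auto intro!: continuous_intros)
  next
    have "((\<lambda>x. complex_of_real ((1 - x\<^sup>2) powr a) * poly f (complex_of_real x)) \<longlongrightarrow>
        complex_of_real 0 * poly f (complex_of_real (-1))) (at_right (-1))"
      using assms
      by (intro tendsto_intros) (auto intro!: tendsto_eq_intros eventually_at_rightI[of "-1" 0] simp: abs_square_le_1 abs_le_iff)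
    then show "(((\<lambda>x. complex_of_real ((1 - x\<^sup>2) powr a) * poly f (complex_of_real x)) \<circ> real_of_ereal) \<longlongrightarrow> 0)
        (at_right (ereal (-1)))"
      unfolding ereal_tendsto_simps by simp
    have "((\<lambda>x. complex_of_real ((1 - x\<^sup>2) powr a) * poly f (complex_of_real x)) \<longlongrightarrow>
        complex_of_real 0 * poly f (complex_of_real 1)) (at_left 1)"
      using assms
      by (intro tendsto_intros) (auto intro!: tendsto_eq_intros eventually_at_leftI[of 0] simp: abs_square_le_1 abs_le_iff)
    then show "(((\<lambda>x. complex_of_real ((1 - x\<^sup>2) powr a) * poly f (complex_of_real x)) \<circ> real_of_ereal) \<longlongrightarrow> 0)
        (at_left (ereal 1))"
      unfolding ereal_tendsto_simps by simp
  qed (use gegenbauer_moments[OF assms] in simp_all)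
  then show ?thesis by simp
qed


subsection \<open>The operators as elements of the Weyl algebra\<close>

lemma map_poly_cnj_numeral [simp]: "map_poly cnj (numeral n) = numeral n"
  by (simp add: numeral_poly map_poly_pCons)

lemma map_poly_cnj_hermite1:
  "map_poly cnj (hermite1 x A C y1 y2) =
     hermite1 (map_poly cnj x) (map_poly cnj A) (map_poly cnj C) (map_poly cnj y1) (map_poly cnj y2)"
  by (simp add: hermite1_def map_poly_cnj_add map_poly_cnj_diff map_poly_cnj_mult map_poly_cnj_pderiv)

lemma map_poly_cnj_hermite2:
  "map_poly cnj (hermite2 x A C y1 y2) =
     hermite2 (map_poly cnj x) (map_poly cnj A) (map_poly cnj C) (map_poly cnj y1) (map_poly cnj y2)"
  by (simp add: hermite2_def map_poly_cnj_add map_poly_cnj_diff map_poly_cnj_mult map_poly_cnj_pderiv)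

lemma map_poly_cnj_gegenbauer1:
  "map_poly cnj (gegenbauer1 x p q y1 y2) =
     gegenbauer1 (map_poly cnj x) (map_poly cnj p) (map_poly cnj q) (map_poly cnj y1) (map_poly cnj y2)"
  by (simp add: gegenbauer1_def map_poly_cnj_add map_poly_cnj_diff map_poly_cnj_mult map_poly_cnj_pderiv)

text \<open>Entry (r, j) of the k-th matrix multiplies the k-th derivative of the r-th component in
  the j-th output; the last branch supplies F_2.\<close>

definition hermite_coeffs :: "complex poly \<Rightarrow> complex poly \<Rightarrow> complex poly \<Rightarrow> nat \<Rightarrow> mpoly2" where
  "hermite_coeffs x A C k =
     (if k = 0 then vector [vector [0, 1 + 2 * A * C], vector [1, 0]]
      else if k = 1 then vector
        [vector [A - C - 4 * A * C * C, (4 * A * C + 8 * A * A * C * C) * x], vector [0, C - A]]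
      else vector
        [vector [- 2 * A * C * C * x, 4 * A * A * C * C * x * x - A * A],
         vector [- C * C, 2 * A * C * C * x]])"

lemma diff_op_hermite:
  "diff_op 2 (hermite_coeffs x A C) P $ i $ 1 = hermite1 x A C (P$i$1) (P$i$2)"
  "diff_op 2 (hermite_coeffs x A C) P $ i $ 2 = hermite2 x A C (P$i$1) (P$i$2)"
  by (simp_all add: diff_op_2_component hermite_coeffs_def hermite1_def hermite2_def) algebra+

definition gegenbauer_coeffs :: "complex poly \<Rightarrow> complex poly \<Rightarrow> complex poly \<Rightarrow> nat \<Rightarrow> mpoly2" where
  "gegenbauer_coeffs x p q k =
     (if k = 0 then vector [vector [0, p * q * (q + 1)], vector [p * q * (p + 1), 0]]
      else if k = 1 then vector
        [vector [2 * p, 2 * p * (q + 1) * x], vector [2 * q * (p + 1) * x, 2 * q]]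
      else vector
        [vector [(p - q) * x, p * x * x - q], vector [q * x * x - p, (q - p) * x]])"

lemma diff_op_gegenbauer:
  "diff_op 2 (gegenbauer_coeffs x p q) P $ i $ 1 = gegenbauer1 x p q (P$i$1) (P$i$2)"
  "diff_op 2 (gegenbauer_coeffs x p q) P $ i $ 2 = gegenbauer1 x q p (P$i$2) (P$i$1)"
  by (simp_all add: diff_op_2_component gegenbauer_coeffs_def gegenbauer1_def) algebra+

lemma mpoly_deg_less_coeff:
  "mpoly_deg_less w P \<Longrightarrow> w \<le> m \<Longrightarrow> coeff (P $ i $ j) m = 0"
  by (simp add: mpoly_deg_less_def mpoly_coeff_def vec_eq_iff)

lemma antidiagonal_square:
  "(vector [vector [0, s], vector [t, 0]] :: mat2) ** vector [vector [0, s], vector [t, 0]] = mat (s * t)"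
  by (simp add: vec_eq_iff matrix_matrix_mult_def mat_def sum_2 forall_2 mult.commute)

lemma mpoly_coeff_antidiagonal:
  assumes "\<And>i. coeff (R $ i $ 1) k = t * coeff (P $ i $ 2) k"
    and "\<And>i. coeff (R $ i $ 2) k = s * coeff (P $ i $ 1) k"
  shows "mpoly_coeff R k = mpoly_coeff P k ** vector [vector [0, s], vector [t, 0]]"
  by (simp add: assms mpoly_coeff_def vec_eq_iff matrix_matrix_mult_def sum_2 forall_2 mult.commute)

lemma mat_exp_nilpotent:
  assumes "A ** A = (0 :: mat2)"
  shows "mat_exp A = mat 1 + A"
proof -
  have "((**) A ^^ k) (mat 1) = 0" if "k \<notin> {..<2}" for k
  proof -
    from that have "2 \<le> k" by simp
    then obtain m where "k = 2 + m" using le_Suc_ex by blast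
    then have "((**) A ^^ k) (mat 1) = (A ** A) ** ((**) A ^^ m) (mat 1)"
      by (simp add: numeral_2_eq_2 matrix_mul_assoc)
    then show ?thesis by (simp add: assms)
  qed
  then have "mat_exp A = (\<Sum>k<2. (1 / fact k) *\<^sub>R (((**) A ^^ k) (mat 1)))"
    unfolding mat_exp_def by (intro suminf_finite) auto
  then show ?thesis by (simp add: numeral_2_eq_2)
qed


subsection \<open>The Hermite type weight\<close>

text \<open>This is e^{xM}, linear in x because M is nilpotent; \<open>A\<close> stands for
  a/2.\<close>

definition hermite_factor :: "complex poly \<Rightarrow> complex poly \<Rightarrow> mpoly2" where
  "hermite_factor x A = vector [vector [1, 2 * A * x], vector [0, 1]]"

lemma hermite_weight_factor:
  "hermite_factor [:0, 1:] [:\<alpha>:] ** (\<chi> i j. if i = j then [:complex_of_real 1:] else 0)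
     ** mpoly_star (hermite_factor [:0, 1:] [:\<alpha>:]) =
   vector [vector [1 + 4 * [:\<alpha>:] * [:cnj \<alpha>:] * [:0, 1:] * [:0, 1:], 2 * [:\<alpha>:] * [:0, 1:]],
           vector [2 * [:cnj \<alpha>:] * [:0, 1:], 1]]"
  by (simp add: vec_eq_iff matrix_matrix_mult_def sum_2 forall_2 hermite_factor_def mpoly_star_def
      map_poly_pCons numeral_poly one_pCons)

lemma W_hermite_eq:
  "W_hermite a t = exp (- t\<^sup>2) *\<^sub>R mpoly_eval
     (vector [vector [1 + 4 * [:a/2:] * [:cnj (a/2):] * [:0, 1:] * [:0, 1:], 2 * [:a/2:] * [:0, 1:]],
              vector [2 * [:cnj (a/2):] * [:0, 1:], 1]]) t"
proof -
  define M :: mat2 where "M = vector [vector [0, a], vector [0, 0]]"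
  have 1: "mat_exp (t *\<^sub>R M) = mat 1 + t *\<^sub>R M"
    by (rule mat_exp_nilpotent)
       (simp add: M_def vec_eq_iff matrix_matrix_mult_def sum_2 forall_2)
  have 2: "mat_exp (t *\<^sub>R ctranspose M) = mat 1 + t *\<^sub>R ctranspose M"
    by (rule mat_exp_nilpotent)
       (simp add: M_def ctranspose_def vec_eq_iff matrix_matrix_mult_def sum_2 forall_2)
  have "mat_exp (t *\<^sub>R M) ** mat_exp (t *\<^sub>R ctranspose M) = mpoly_eval
     (vector [vector [1 + 4 * [:a/2:] * [:cnj (a/2):] * [:0, 1:] * [:0, 1:], 2 * [:a/2:] * [:0, 1:]],
              vector [2 * [:cnj (a/2):] * [:0, 1:], 1]]) t"
    unfolding 1 2
    by (simp add: M_def ctranspose_def mpoly_eval_def vec_eq_iff matrix_matrix_mult_def mat_def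
        sum_2 forall_2 numeral_poly one_pCons scaleR_conv_of_real[where 'a = complex] algebra_simps)
  then show ?thesis by (simp add: W_hermite_def Let_def M_def[symmetric])
qed

lemma centralizer_center_hermite:
  assumes "a \<noteq> 0"
  shows "Weyl_centralizer (Weyl_center (DW UNIV (W_hermite a))) = DW UNIV (W_hermite a)"
proof -
  define \<alpha> where "\<alpha> = a / 2"
  \<comment> \<open>This is the real form of 2AC, equal to |a|^2 / 2; its positivity makes
    \<open>\<nu>\<close> strictly increasing.\<close>
  define \<kappa> where "\<kappa> = 2 * (cmod \<alpha>)\<^sup>2"
  define x :: "complex poly" where "x = [:0, 1:]"
  define A C where "A = [:\<alpha>:]" and "C = [:cnj \<alpha>:]"
  have cnj_atoms: "map_poly cnj x = x" "map_poly cnj A = C" "map_poly cnj C = A"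
    by (simp_all add: x_def A_def C_def map_poly_pCons)
  have \<kappa>: "complex_of_real \<kappa> = 2 * \<alpha> * cnj \<alpha>"
    by (simp only: \<kappa>_def of_real_mult of_real_numeral complex_norm_square mult.assoc)
  have \<kappa>_pos: "0 < \<kappa>"
    using assms by (simp add: \<kappa>_def \<alpha>_def)
  interpret polynomial_weight UNIV "W_hermite a" "\<lambda>x. exp (- x\<^sup>2)" 1 "[:0, -2:]"
    "hermite_factor [:0, 1:] [:\<alpha>:]" "\<lambda>_. 1"
  proof
    show "P = 0" if "P ** hermite_factor [:0, 1:] [:\<alpha>:] = 0" for P :: mpoly2
      using that by (auto simp add: hermite_factor_def vec_eq_iff matrix_matrix_mult_def sum_2 forall_2)
  qed (use hermite_pearson in \<open>simp_all only: hermite_weight_factor W_hermite_eq \<alpha>_def hermite_moments\<close>, simp_all)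
  have V_eq: "V = vector [vector [1 + 4 * A * C * x * x, 2 * A * x], vector [2 * C * x, 1]]"
    unfolding V_def x_def A_def C_def by (rule hermite_weight_factor)
  define S where "S = diff_op 2 (hermite_coeffs x A C)"
  define \<nu> where "\<nu> k = (1 + \<kappa> * real k) * (1 + \<kappa> * real (Suc k))" for k
  interpret bispectral_form UNIV "W_hermite a" S
    "\<lambda>k. vector [vector [0, complex_of_real (\<nu> k)], vector [1, 0]]" "\<lambda>k. complex_of_real (\<nu> k) * 1"
  proof
    show "S \<in> Weyl" by (auto simp: S_def Weyl_def)
    show "mform UNIV (W_hermite a) (S P) Q = mform UNIV (W_hermite a) P (S Q)" for P Q
    proof (rule symmetricI)
      fix i j
      have "pderiv x = 1" "pderiv A = 0" "pderiv C = 0"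
        by (simp_all add: x_def A_def C_def pderiv_pCons)
      note * = hermite_concomitant[OF this]
      define y1 y2 z1 z2 where y_z: "y1 = P$i$1" "y2 = P$i$2"
        "z1 = map_poly cnj (Q$j$1)" "z2 = map_poly cnj (Q$j$2)"
      have "[:0, -2:] = - 2 * x" by (simp add: x_def numeral_poly)
      moreover have "(S P ** V ** mpoly_star Q) $ i $ j - (P ** V ** mpoly_star (S Q)) $ i $ j =
          hermite1 x A C y1 y2 * ((1 + 4*A*C*x*x) * z1 + 2*A*x*z2) + hermite2 x A C y1 y2 * (2*C*x*z1 + z2)
          - (((1 + 4*A*C*x*x) * y1 + 2*C*x*y2) * hermite1 x C A z1 z2
             + (2*A*x*y1 + y2) * hermite2 x C A z1 z2)"
        by (simp add: y_z V_eq S_def matrix_matrix_mult_def sum_2 mpoly_star_def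
            diff_op_hermite map_poly_cnj_hermite1 map_poly_cnj_hermite2 cnj_atoms algebra_simps)
      ultimately show "\<exists>G. (S P ** V ** mpoly_star Q) $ i $ j - (P ** V ** mpoly_star (S Q)) $ i $ j =
          1 * pderiv G + [:0, -2:] * G"
        using * by simp
    qed
    show "mpoly_coeff (S P) k = mpoly_coeff P k ** vector [vector [0, complex_of_real (\<nu> k)], vector [1, 0]]"
      if "mpoly_deg_less (Suc k) P" for k P
      using mpoly_deg_less_coeff[OF that]
      by (intro mpoly_coeff_antidiagonal)
         (simp_all add: S_def diff_op_hermite x_def A_def C_def hermite_leading \<nu>_def \<kappa>)
    show "inj (\<lambda>k. complex_of_real (\<nu> k) * 1)"
    proof -
      have "strict_mono \<nu>"
        unfolding strict_mono_Suc_iff \<nu>_def using \<kappa>_pos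
        by (intro allI mult_strict_mono) (auto intro: add_pos_nonneg)
      from strict_mono_eq[OF this] show ?thesis by (simp add: inj_def)
    qed
  qed (rule antidiagonal_square)
  show ?thesis by (rule centralizer_center)
qed


subsection \<open>The Gegenbauer type weight\<close>

text \<open>Its determinant is 1 - x^2, so it is singular at both endpoints and has no polynomial
  inverse; as 1 - x^2 is a nonzero polynomial, it can still be cancelled.\<close>

definition gegenbauer_factor :: "complex poly \<Rightarrow> mpoly2" where
  "gegenbauer_factor x = vector [vector [x, 1], vector [-1, - x]]"

lemma gegenbauer_factor_cancel:
  assumes "P ** gegenbauer_factor x = 0" "x * x \<noteq> 1"
  shows "P = (0 :: mpoly2)"
proof -
  have "P$i$1 = 0 \<and> P$i$2 = 0" for i
  proof -
    have "(P ** gegenbauer_factor x) $ i $ j = 0" for j using assms(1) by simp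
    from this[of 1] this[of 2] have "P$i$2 = P$i$1 * x" "P$i$1 = P$i$2 * x"
      by (simp_all add: gegenbauer_factor_def matrix_matrix_mult_def sum_2)
    moreover from this have "P$i$1 * (x * x - 1) = 0"
      by (simp add: algebra_simps)
    ultimately show ?thesis using assms(2) by auto
  qed
  then show ?thesis by (simp add: vec_eq_iff forall_2)
qed

lemma gegenbauer_weight_factor:
  "gegenbauer_factor [:0, 1:] ** (\<chi> i j. if i = j then [:complex_of_real (if i = 1 then p else q):] else 0)
     ** mpoly_star (gegenbauer_factor [:0, 1:]) =
   (let x = [:0, 1:]; p = [:complex_of_real p:]; q = [:complex_of_real q:]
    in vector [vector [p * x * x + q, - (p + q) * x], vector [- (p + q) * x, q * x * x + p]])"
  by (simp add: vec_eq_iff matrix_matrix_mult_def sum_2 forall_2 gegenbauer_factor_def mpoly_star_def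
      map_poly_pCons one_pCons Let_def)

lemma W_gegenbauer_eq:
  "W_gegenbauer p n t = (1 - t\<^sup>2) powr (n / 2 - 1) *\<^sub>R mpoly_eval
     (let x = [:0, 1:]; q = [:complex_of_real (n - p):]; p = [:complex_of_real p:]
      in vector [vector [p * x * x + q, - (p + q) * x], vector [- (p + q) * x, q * x * x + p]]) t"
proof -
  have "vector [vector [complex_of_real (p * t\<^sup>2 + n - p), complex_of_real (- n * t)],
             vector [complex_of_real (- n * t), complex_of_real ((n - p) * t\<^sup>2 + p)]] = mpoly_eval
     (let x = [:0, 1:]; q = [:complex_of_real (n - p):]; p = [:complex_of_real p:]
      in vector [vector [p * x * x + q, - (p + q) * x], vector [- (p + q) * x, q * x * x + p]]) t"
    by (simp add: mpoly_eval_def vec_eq_iff forall_2 Let_def power2_eq_square algebra_simps)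
  then show ?thesis by (simp add: W_gegenbauer_def)
qed

lemma centralizer_center_gegenbauer:
  assumes "0 < p" "p < n / 2"
  shows "Weyl_centralizer (Weyl_center (DW {-1<..<1} (W_gegenbauer p n))) = DW {-1<..<1} (W_gegenbauer p n)"
proof -
  define q where "q = n - p"
  define x :: "complex poly" where "x = [:0, 1:]"
  define A B where "A = [:complex_of_real p:]" and "B = [:complex_of_real q:]"
  have cnj_atoms: "map_poly cnj x = x" "map_poly cnj A = A" "map_poly cnj B = B"
    by (simp_all add: x_def A_def B_def map_poly_pCons)
  have pos: "0 < p" "0 < q" "0 < n" using assms by (simp_all add: q_def)
  let ?d = "\<lambda>i::2. if i = 1 then p else q"
  interpret polynomial_weight "{-1<..<1}" "W_gegenbauer p n" "\<lambda>x. (1 - x\<^sup>2) powr (n / 2 - 1)"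
    "[:1, 0, -1:]" "[:0, - complex_of_real n:]" "gegenbauer_factor [:0, 1:]" ?d
  proof
    show "emeasure lborel {-1<..<1::real} \<noteq> 0" by simp
    show "0 < (1 - x\<^sup>2) powr (n / 2 - 1)" if "x \<in> {-1<..<1}" for x :: real
      using that abs_square_eq_1[of x] by (auto simp: abs_less_iff)
    show "set_integrable lborel {-1<..<1} (\<lambda>x. (1 - x\<^sup>2) powr (n / 2 - 1) * x ^ k)" for k
      using gegenbauer_moments[of "n / 2"] pos by simp
    show "(LINT x:{-1<..<1}|lborel. complex_of_real ((1 - x\<^sup>2) powr (n / 2 - 1)) *
        poly ([:1, 0, -1:] * pderiv f + [:0, - complex_of_real n:] * f) (complex_of_real x)) = 0" for f
      using gegenbauer_pearson[of "n / 2" f] pos by simp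
    show "W_gegenbauer p n t = (1 - t\<^sup>2) powr (n / 2 - 1) *\<^sub>R mpoly_eval
        (gegenbauer_factor [:0, 1:] ** (\<chi> i j. if i = j then [:complex_of_real (?d i):] else 0)
          ** mpoly_star (gegenbauer_factor [:0, 1:])) t" for t
      unfolding gegenbauer_weight_factor W_gegenbauer_eq by (simp add: q_def Let_def)
    show "0 < ?d i" for i using pos by simp
    show "P = 0" if zero: "P ** gegenbauer_factor [:0, 1:] = 0" for P :: mpoly2
      using gegenbauer_factor_cancel[OF zero] by (simp add: one_pCons)
  qed simp
  have V_eq: "V = vector [vector [A * x * x + B, - (A + B) * x], vector [- (A + B) * x, B * x * x + A]]"
    unfolding V_def x_def A_def B_def gegenbauer_weight_factor Let_def ..
  define S where "S = diff_op 2 (gegenbauer_coeffs x A B)"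
  \<comment> \<open>The k-dependent factor of the leading coefficients: \<open>r\<close> is q above
    the diagonal and p below it, and both families increase in k since p and q are positive.\<close>
  define \<nu> where "\<nu> r k = (real k + r) * (real k + r + 1)" for r k
  let ?s = "\<lambda>k. complex_of_real (p * \<nu> q k)" and ?t = "\<lambda>k. complex_of_real (q * \<nu> p k)"
  interpret bispectral_form "{-1<..<1}" "W_gegenbauer p n" S
    "\<lambda>k. vector [vector [0, ?s k], vector [?t k, 0]]" "\<lambda>k. ?s k * ?t k"
  proof
    show "S \<in> Weyl" by (auto simp: S_def Weyl_def)
    show "mform {-1<..<1} (W_gegenbauer p n) (S P) Q = mform {-1<..<1} (W_gegenbauer p n) P (S Q)" for P Q
    proof (rule symmetricI)
      fix i j
      have "pderiv x = 1" "pderiv A = 0" "pderiv B = 0"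
        by (simp_all add: x_def A_def B_def pderiv_pCons)
      note * = gegenbauer_concomitant[OF this]
      define y1 y2 z1 z2 where y_z: "y1 = P$i$1" "y2 = P$i$2"
        "z1 = map_poly cnj (Q$j$1)" "z2 = map_poly cnj (Q$j$2)"
      have "[:1, 0, -1:] = 1 - x * x" "[:0, - complex_of_real n:] = - (A + B) * x"
        by (simp_all add: x_def A_def B_def q_def one_pCons)
      moreover have "(S P ** V ** mpoly_star Q) $ i $ j - (P ** V ** mpoly_star (S Q)) $ i $ j =
          gegenbauer1 x A B y1 y2 * ((A*x*x+B) * z1 - (A+B)*x*z2)
          + gegenbauer1 x B A y2 y1 * ((B*x*x+A) * z2 - (A+B)*x*z1)
          - (((A*x*x+B) * y1 - (A+B)*x*y2) * gegenbauer1 x A B z1 z2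
             + ((B*x*x+A) * y2 - (A+B)*x*y1) * gegenbauer1 x B A z2 z1)"
        by (simp add: y_z V_eq S_def matrix_matrix_mult_def sum_2 mpoly_star_def
            diff_op_gegenbauer map_poly_cnj_gegenbauer1 cnj_atoms algebra_simps)
      ultimately show "\<exists>G. (S P ** V ** mpoly_star Q) $ i $ j - (P ** V ** mpoly_star (S Q)) $ i $ j =
          [:1, 0, -1:] * pderiv G + [:0, - complex_of_real n:] * G"
        using * by simp
    qed
    show "mpoly_coeff (S P) k = mpoly_coeff P k ** vector [vector [0, ?s k], vector [?t k, 0]]"
      if "mpoly_deg_less (Suc k) P" for k P
      using mpoly_deg_less_coeff[OF that]
      by (intro mpoly_coeff_antidiagonal)
         (simp_all add: S_def diff_op_gegenbauer x_def A_def B_def gegenbauer_leading \<nu>_def mult.assoc)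
    show "inj (\<lambda>k. ?s k * ?t k)"
    proof -
      have \<nu>: "0 < \<nu> r k" "\<nu> r k < \<nu> r (Suc k)" if "0 < r" for r k
        unfolding \<nu>_def using that by (auto intro!: mult_strict_mono mult_pos_pos add_nonneg_pos)
      have "strict_mono (\<lambda>k. p * \<nu> q k * (q * \<nu> p k))"
        unfolding strict_mono_Suc_iff
        by (rule allI, rule mult_strict_mono) (use pos \<nu> in \<open>auto intro: less_imp_le\<close>)
      from strict_mono_eq[OF this] show ?thesis
        unfolding of_real_mult[symmetric] of_real_eq_iff inj_def by blast
    qed
  qed (rule antidiagonal_square)
  show ?thesis by (rule centralizer_center)
qed

theorem corollary7p3:
  fixes I :: "real set" and W :: "real \<Rightarrow> complex^2^2"
  assumes "(I = {-1<..<1} \<and> (\<exists>p n :: real. 0 < p \<and> p < n / 2 \<and> W = W_gegenbauer p n))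
         \<or> (I = UNIV \<and> (\<exists>a :: complex. a \<noteq> 0 \<and> W = W_hermite a))"
  shows "Weyl_centralizer (Weyl_center (DW I W)) = DW I W"
  using assms centralizer_center_gegenbauer centralizer_center_hermite by blast

end
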